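(* There exists an aperiodic function $f\in\mathcal{M}$ which is neither strongly aperiodic nor moderately aperiodic.
   Context: $\mathcal{M}$ is the class of multiplicative functions $f:\mathbb{N}\to\mathbb{C}$ ($f(mn)=f(m)f(n)$ for coprime $m,n$) with $|f|\le1$; $p$ denotes a prime and $\chi$ runs over Dirichlet characters of modulus $q$. $f\in\mathcal{M}$ is aperiodic if its Cesàro averages along every infinite arithmetic progression tend to $0$: $\frac1N\sum_{n\le N}f(an+b)\to0$ for all $a\in\mathbb{N}$, $b\in\mathbb{N}\cup\{0\}$. $f$ is strongly aperiodic if for all $Q\ge1$, $$\lim_{X\to\infty}\inf_{|t|\le X}\min_{\chi\bmod q,\ q\le Q}\sum_{p\le X}\frac1p\big(1-\mathrm{Re}(f(p)\chi(p)p^{it})\big)=+\infty.$$ $f$ is moderately aperiodic if $f$ is aperiodic and for some $A>0$, $$\lim_{X\to\infty}\frac1{\log\log X}\inf_{|t|\le X^A}\min_{\chi\bmod q,\ q\le(\log X)^A}\sum_{p\le X}\frac1p\big(1-\mathrm{Re}(f(p)\chi(p)p^{it})\big)=0.$$ *)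

theory Defs
  imports "HOL-Analysis.Analysis" "HOL-Number_Theory.Number_Theory"
begin

(* Arithmetic functions on the positive integers are functions on nat whose
   value at 0 is irrelevant: nothing below constrains or uses f 0. *)
definition bounded_multiplicative :: "(nat \<Rightarrow> complex) set" where
  "bounded_multiplicative = {f.
     (\<forall>m n. 1 \<le> m \<longrightarrow> 1 \<le> n \<longrightarrow> coprime m n \<longrightarrow> f (m * n) = f m * f n) \<and>
     (\<forall>n. 1 \<le> n \<longrightarrow> norm (f n) \<le> 1)}"

definition aperiodic :: "(nat \<Rightarrow> complex) \<Rightarrow> bool" where
  "aperiodic f \<longleftrightarrow>
     (\<forall>a b. 1 \<le> a \<longrightarrow> (\<lambda>N. (\<Sum>n=1..N. f (a * n + b)) / of_nat N) \<longlonglongrightarrow> 0)"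

definition dirichlet_character :: "nat \<Rightarrow> (nat \<Rightarrow> complex) \<Rightarrow> bool" where
  "dirichlet_character q chi \<longleftrightarrow>
     (\<forall>m n. chi (m * n) = chi m * chi n) \<and>
     (\<forall>n. chi (n + q) = chi n) \<and>
     (\<forall>n. chi n \<noteq> 0 \<longleftrightarrow> coprime n q)"

definition pretentious_sum :: "(nat \<Rightarrow> complex) \<Rightarrow> (nat \<Rightarrow> complex) \<Rightarrow> real \<Rightarrow> real \<Rightarrow> real" where
  "pretentious_sum f chi t X =
     (\<Sum>p | prime p \<and> real p \<le> X.
        1 / real p * (1 - Re (f p * chi p * of_nat p powr (\<i> * of_real t))))"

definition characters_upto :: "real \<Rightarrow> (nat \<Rightarrow> complex) set" where
  "characters_upto Q = {chi. \<exists>q\<ge>1. real q \<le> Q \<and> dirichlet_character q chi}"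

definition min_pretentious_sum :: "(nat \<Rightarrow> complex) \<Rightarrow> real \<Rightarrow> real \<Rightarrow> real \<Rightarrow> real" where
  "min_pretentious_sum f X T Q =
     (INF t\<in>{t. \<bar>t\<bar> \<le> T}. MIN chi\<in>characters_upto Q. pretentious_sum f chi t X)"

definition strongly_aperiodic :: "(nat \<Rightarrow> complex) \<Rightarrow> bool" where
  "strongly_aperiodic f \<longleftrightarrow>
     (\<forall>Q\<ge>1. filterlim (\<lambda>X. min_pretentious_sum f X X Q) at_top at_top)"

definition moderately_aperiodic :: "(nat \<Rightarrow> complex) \<Rightarrow> bool" where
  "moderately_aperiodic f \<longleftrightarrow> aperiodic f \<and>
     (\<exists>A>0. ((\<lambda>X. 1 / ln (ln X) * min_pretentious_sum f X (X powr A) (ln X powr A))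
              \<longlongrightarrow> 0) at_top)"

(* The next facts make sure that Min and Inf in min_pretentious_sum are genuine:
   the set of characters is finite and nonempty, and the sums are nonnegative. *)

lemma dirichlet_character_mod:
  assumes "dirichlet_character q chi"
  shows "chi (n mod q) = chi n"
proof -
  have "chi (m + k * q) = chi m" for m k
  proof (induction k)
    case (Suc k)
    have "chi (m + Suc k * q) = chi ((m + k * q) + q)" by (simp add: algebra_simps)
    also have "\<dots> = chi (m + k * q)" using assms unfolding dirichlet_character_def by blast
    finally show ?case using Suc by simp
  qed simp
  from this[of "n mod q" "n div q"] show ?thesis by simp
qed

lemma dirichlet_character_one:
  assumes "dirichlet_character q chi"
  shows "chi 1 = 1"
proof -
  have "chi (1 * 1) = chi 1 * chi 1" "chi 1 \<noteq> 0"
    using assms unfolding dirichlet_character_def by (blast, simp)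
  then show ?thesis by simp
qed

lemma dirichlet_character_root_of_unity:
  assumes "dirichlet_character q chi" and "coprime n q"
  shows "chi n ^ totient q = 1"
proof -
  have pow: "chi (n ^ k) = chi n ^ k" for k
  proof (induction k)
    case 0
    then show ?case using dirichlet_character_one[OF assms(1)] by simp
  next
    case (Suc k)
    then show ?case using assms(1) unfolding dirichlet_character_def by simp
  qed
  have "[n ^ totient q = 1] (mod q)" using euler_theorem[OF assms(2)] .
  then have "chi (n ^ totient q) = chi 1"
    using dirichlet_character_mod[OF assms(1), of "n ^ totient q"]
      dirichlet_character_mod[OF assms(1), of 1] unfolding cong_def by simp
  then show ?thesis using pow dirichlet_character_one[OF assms(1)] by simp
qed

lemma norm_dirichlet_character_le:
  assumes "dirichlet_character q chi" and "1 \<le> q"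
  shows "norm (chi n) \<le> 1"
proof (cases "coprime n q")
  case True
  have "norm (chi n) ^ totient q = 1"
    using dirichlet_character_root_of_unity[OF assms(1) True] by (simp flip: norm_power)
  moreover have "totient q > 0" using assms(2) by simp
  ultimately show ?thesis using power_eq_1_iff[of "norm (chi n)" "totient q"] by simp
next
  case False
  then have "chi n = 0" using assms(1) unfolding dirichlet_character_def by blast
  then show ?thesis by simp
qed

lemma finite_dirichlet_character:
  assumes "1 \<le> q"
  shows "finite {chi. dirichlet_character q chi}"
proof -
  let ?R = "insert 0 {z :: complex. z ^ totient q = 1}"
  have "totient q > 0" using assms by simp
  then have "finite {z :: complex. z ^ totient q = 1}"
    by (intro finite_roots_unity) linarith
  then have fin: "finite ({..<q} \<rightarrow>\<^sub>E ?R)" by (intro finite_PiE) auto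
  have "(\<lambda>chi. restrict chi {..<q}) ` {chi. dirichlet_character q chi} \<subseteq> {..<q} \<rightarrow>\<^sub>E ?R"
  proof (rule image_subsetI)
    fix chi assume "chi \<in> {chi. dirichlet_character q chi}"
    then have *: "dirichlet_character q chi" by simp
    have "chi n \<in> ?R" for n
      using * dirichlet_character_root_of_unity[OF *, of n]
      unfolding dirichlet_character_def by blast
    then show "restrict chi {..<q} \<in> {..<q} \<rightarrow>\<^sub>E ?R" by auto
  qed
  moreover have "inj_on (\<lambda>chi. restrict chi {..<q}) {chi. dirichlet_character q chi}"
  proof (rule inj_onI, rule ext)
    fix chi psi n
    assume a: "chi \<in> {chi. dirichlet_character q chi}" "psi \<in> {chi. dirichlet_character q chi}"
      and eq: "restrict chi {..<q} = restrict psi {..<q}"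
    have "n mod q < q" using assms by simp
    then have "chi (n mod q) = psi (n mod q)" using fun_cong[OF eq, of "n mod q"] by simp
    then show "chi n = psi n" using a by (simp add: dirichlet_character_mod)
  qed
  ultimately show ?thesis using fin by (meson finite_imageD finite_subset)
qed

lemma finite_characters_upto: "finite (characters_upto Q)"
proof (rule finite_subset)
  show "characters_upto Q \<subseteq> (\<Union>q\<in>{1..nat \<lfloor>Q\<rfloor>}. {chi. dirichlet_character q chi})"
    unfolding characters_upto_def by (force simp: le_nat_floor)
  show "finite (\<Union>q\<in>{1..nat \<lfloor>Q\<rfloor>}. {chi. dirichlet_character q chi})"
    by (intro finite_UN_I finite_dirichlet_character) auto
qed

lemma characters_upto_nonempty:
  assumes "1 \<le> Q"
  shows "characters_upto Q \<noteq> {}"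
proof -
  have "dirichlet_character 1 (\<lambda>_. 1)" unfolding dirichlet_character_def by simp
  then have "(\<lambda>_. 1) \<in> characters_upto Q"
    using assms unfolding characters_upto_def by (auto intro!: exI[of _ 1])
  then show ?thesis by blast
qed

lemma pretentious_sum_nonneg:
  assumes "f \<in> bounded_multiplicative" and "chi \<in> characters_upto Q"
  shows "0 \<le> pretentious_sum f chi t X"
  unfolding pretentious_sum_def
proof (intro sum_nonneg mult_nonneg_nonneg)
  fix p assume "p \<in> {p. prime p \<and> real p \<le> X}"
  then have p: "p > 0" by (simp add: prime_gt_0_nat)
  have f: "norm (f p) \<le> 1" using assms(1) p unfolding bounded_multiplicative_def by simp
  have c: "norm (chi p) \<le> 1"
    using assms(2) norm_dirichlet_character_le unfolding characters_upto_def by blast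
  have "norm (of_nat p powr (\<i> * of_real t) :: complex) = 1"
    using p by (simp add: powr_def)
  then have "norm (f p * chi p * of_nat p powr (\<i> * of_real t)) \<le> 1"
    using mult_mono[OF f c] by (simp add: norm_mult)
  then show "0 \<le> 1 - Re (f p * chi p * of_nat p powr (\<i> * of_real t))"
    using complex_Re_le_cmod[of "f p * chi p * of_nat p powr (\<i> * of_real t)"] by linarith
qed simp

end

(* The function is completely multiplicative with unimodular values at the primes, and these values
   are chosen in stages, each of which fixes them up to some bound; every stage serves one of three
   aims and works after any choice of the earlier values.
   (1) On a block of primes whose reciprocals have a large sum, let the signs alternate within each
   residue class mod k!. By the Turan-Kubilius inequality this alone makes the averages along all
   progressions of modulus at most k small in the limit, whatever is chosen later.
   (2) Up to some z, choose signs at most primes by a greedy algorithm against a finite net of all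
   twists chi(p) p^(it) with t <= z^k and modulus <= (log z)^k, so that f stays at distance
   >> log log z from them: f is not moderately aperiodic.
   (3) By Kronecker's theorem some p^(-it) approximates the values chosen so far; take f(p) = p^(-it)
   for the following primes up to a bound exceeding |t|: f is not strongly aperiodic. *)
theory Submission
  imports Defs "HOL-Computational_Algebra.Squarefree" "HOL-Real_Asymp.Real_Asymp"
begin

text \<open>The aims pull in opposite directions: imitating p^(-it) on long ranges of primes
  threatens aperiodicity, which concerns all large x. They are compatible because each needs only
  one suitable stage for every k. The failure of a limit is witnessed by an unbounded set of scales,
  and a scale sees only the primes below it. Aperiodicity looks like a property of the whole
  function, yet a single block bounds the relative size of the sums by sqrt (2 / L) plus a term that
  shrinks with the lower end of the block, where L is the sum of 1/p over the block; the threshold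
  for x depends on the block alone. As the sum of 1/p diverges, such a block exists above any bound.
  Every requirement is thus a dense open condition on the values at the primes, and countably many
  of them are met together as in the Baire category theorem. In (3) Kronecker's theorem gives no
  control over the size of t; this does no harm, since the range on which f copies p^(-it) is chosen
  after t.\<close>

section \<open>Sums of reciprocals of primes\<close>

lemma sum_inverse_squares_le:
  "(\<Sum>r=1..n. 1 / (real r)\<^sup>2) \<le> 2"
proof -
  have "(\<Sum>r=1..Suc n. 1 / (real r)\<^sup>2) \<le> 2 - 1 / real (Suc n)" for n
  proof (induction n)
    case (Suc n)
    have "1 / (real (Suc (Suc n)))\<^sup>2 \<le> 1 / (real (Suc n) * real (Suc (Suc n)))"
      by (intro divide_left_mono) (auto simp: power2_eq_square)
    also have "\<dots> = 1 / real (Suc n) - 1 / real (Suc (Suc n))"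
      by (simp add: field_simps)
    finally show ?case using Suc by simp
  qed simp
  from this[of "n - 1"] show ?thesis
    by (cases n) (auto intro: order_trans)
qed

text \<open>Each n is a squarefree number times a square, hence determined by the set
  \<open>S n\<close> of primes and by \<open>square_part n\<close>. Expanding the product over all
  subsets of the primes up to \<open>z\<close> and multiplying by the sum of 1/r^2 covers every 1/n
  once; the latter sum gives the factor 2.\<close>

lemma harmonic_le_prod_primes:
  "(\<Sum>n=1..z. 1 / real n) \<le> 2 * (\<Prod>p | prime p \<and> p \<le> z. 1 + 1 / real p)"
proof -
  define P where "P = {p. prime p \<and> p \<le> z}"
  define S where "S n = prime_factors (squarefree_part n)" for n :: nat
  define g where "g = (\<lambda>(A, r). (\<Prod>p\<in>A. 1 / real p) * (1 / (real r)\<^sup>2))"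
  have finP: "finite P" unfolding P_def by simp
  have dec: "n = \<Prod>(S n) * (square_part n)\<^sup>2" for n
  proof -
    have "squarefree_part n = (\<Prod>p\<in>S n. p ^ multiplicity p (squarefree_part n))"
      using prod_prime_factors[of "squarefree_part n"] by (simp add: S_def)
    also have "\<dots> = \<Prod>(S n)"
      using squarefree_squarefree_part[of n] squarefree_factorial_semiring'[of "squarefree_part n"]
      by (intro prod.cong) (auto simp: S_def)
    finally show ?thesis using squarefree_decompose[of n] by simp
  qed
  have inj: "inj_on (\<lambda>n. (S n, square_part n)) {1..z}"
  proof (rule inj_onI)
    fix m n assume "m \<in> {1..z}" "n \<in> {1..z}" "(S m, square_part m) = (S n, square_part n)"
    then show "m = n" using dec[of m] dec[of n] by simp
  qed
  have sub: "(\<lambda>n. (S n, square_part n)) ` {1..z} \<subseteq> Pow P \<times> {1..z}"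
  proof (rule image_subsetI)
    fix n assume n: "n \<in> {1..z}"
    have "p \<le> z" if "p \<in> S n" for p
    proof -
      have "p dvd n" using that squarefree_decompose[of n] unfolding S_def
        by (metis dvd_mult2 in_prime_factors_iff)
      then show ?thesis using n dvd_imp_le[of p n] by auto
    qed
    moreover have "square_part n \<le> n"
    proof -
      have "square_part n dvd n" using dvd_trans[OF _ square_part_square_dvd[of n], of "square_part n"] by simp
      then show ?thesis using n by (auto intro: dvd_imp_le)
    qed
    moreover have "square_part n \<ge> 1" using n by (cases "square_part n") auto
    ultimately show "(S n, square_part n) \<in> Pow P \<times> {1..z}"
      using n unfolding P_def S_def by auto
  qed
  have "(\<Sum>n=1..z. 1 / real n) = (\<Sum>n\<in>{1..z}. g (S n, square_part n))"
  proof (intro sum.cong refl)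
    fix n assume "n \<in> {1..z}"
    then have "real n = (\<Prod>p\<in>S n. real p) * (real (square_part n))\<^sup>2"
      using arg_cong[OF dec[of n], of real] by (simp add: prod.distrib)
    then show "1 / real n = g (S n, square_part n)" unfolding g_def by (simp add: prod_dividef)
  qed
  also have "\<dots> = sum g ((\<lambda>n. (S n, square_part n)) ` {1..z})"
    using inj by (simp add: sum.reindex)
  also have "\<dots> \<le> sum g (Pow P \<times> {1..z})"
    using sub finP by (intro sum_mono2) (auto simp: g_def intro!: divide_nonneg_nonneg prod_nonneg)
  also have "\<dots> = (\<Sum>A\<in>Pow P. \<Prod>p\<in>A. 1 / real p) * (\<Sum>r=1..z. 1 / (real r)\<^sup>2)"
    unfolding g_def by (simp add: sum.cartesian_product[symmetric] sum_product)
  also have "(\<Sum>A\<in>Pow P. \<Prod>p\<in>A. 1 / real p) = (\<Prod>p\<in>P. 1 / real p + 1)"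
    using prod_add[OF finP, of "\<lambda>p. 1 / real p" "\<lambda>_. 1"] by simp
  also have "(\<Prod>p\<in>P. 1 / real p + 1) * (\<Sum>r=1..z. 1 / (real r)\<^sup>2) \<le> (\<Prod>p\<in>P. 1 / real p + 1) * 2"
    by (intro mult_left_mono sum_inverse_squares_le prod_nonneg) auto
  finally show ?thesis unfolding P_def by (simp add: add.commute mult.commute)
qed

text \<open>Logarithms are taken in the product bound after 1 + y \<le> exp y. The harmonic sum is
  at least \<open>ln z\<close>, and the factor 2 costs ln 2, which is below 1.\<close>

lemma prime_reciprocals_ge:
  assumes "z \<ge> 2"
  shows "ln (ln (real z)) - 1 \<le> (\<Sum>p | prime p \<and> p \<le> z. 1 / real p)"
proof -
  let ?s = "\<Sum>p | prime p \<and> p \<le> z. 1 / real p"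
  have "ln (real z) \<le> ln (real z + 1)" using assms by simp
  also have "\<dots> \<le> (\<Sum>n=1..z. 1 / real n)"
    using ln_le_harm[of z] by (simp add: harm_def inverse_eq_divide)
  also note harmonic_le_prod_primes
  also have "(\<Prod>p | prime p \<and> p \<le> z. 1 + 1 / real p) \<le> (\<Prod>p | prime p \<and> p \<le> z. exp (1 / real p))"
    by (intro prod_mono) auto
  also have "\<dots> = exp ?s" by (simp add: exp_sum)
  finally have "ln (real z) \<le> 2 * exp ?s" by simp
  then have "ln (ln (real z)) \<le> ln (2 * exp ?s)" using assms by (subst ln_le_cancel_iff) auto
  also have "\<dots> = ln 2 + ?s" by (simp add: ln_mult)
  finally show ?thesis using ln2_le_25_over_36 by simp
qed

text \<open>Every prime except 2 is odd and is charged to the even number just below it, so half of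
  a harmonic sum suffices. The factor 1/2 matters: for \<open>w\<close> of the order of
  \<open>ln z\<close> the primes up to \<open>w\<close> take only about half of the
  \<open>ln (ln z)\<close> that the primes up to \<open>z\<close> supply.\<close>

lemma prime_reciprocals_le:
  assumes "w \<ge> 1"
  shows "(\<Sum>p | prime p \<and> p \<le> w. 1 / real p) \<le> 1 + ln (real w) / 2"
proof -
  have none: "(\<Sum>p | prime p \<and> p \<le> Suc 0. 1 / real p) = 0"
    by (rule sum.neutral) (auto dest: prime_gt_1_nat)
  have *: "(\<Sum>p | prime p \<and> p \<le> Suc n. 1 / real p) \<le> 1/2 + (\<Sum>j=1..n div 2. 1 / real (2 * j))" for n
  proof (induction n)
    case 0
    show ?case using none by simp
  next
    case (Suc n)
    have eq: "{p. prime p \<and> p \<le> Suc (Suc n)} = {p. prime p \<and> p \<le> Suc n} \<union> (if prime (Suc (Suc n)) then {Suc (Suc n)} else {})"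
      by (auto simp: le_Suc_eq)
    have mono: "(\<Sum>j=1..n div 2. 1 / real (2 * j)) \<le> (\<Sum>j=1..Suc n div 2. 1 / real (2 * j))"
      by (intro sum_mono2) auto
    show ?case
    proof (cases "prime (Suc (Suc n))")
      case False
      then show ?thesis using Suc mono eq by simp
    next
      case True
      then have sum: "(\<Sum>p | prime p \<and> p \<le> Suc (Suc n). 1 / real p) =
          (\<Sum>p | prime p \<and> p \<le> Suc n. 1 / real p) + 1 / real (Suc (Suc n))"
        unfolding eq by (simp add: sum.insert_if)
      show ?thesis
      proof (cases "n = 0")
        case True
        then show ?thesis unfolding sum using none by simp
      next
        case False
        then have "odd (Suc (Suc n))" using prime_odd_nat[of "Suc (Suc n)"] \<open>prime (Suc (Suc n))\<close> by simp
        then obtain m where m: "n = 2 * m + 1" by (auto elim!: oddE)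
        then have "1 / real (Suc (Suc n)) \<le> 1 / real (2 * Suc m)"
          by (intro divide_left_mono) auto
        then show ?thesis unfolding sum using Suc m by simp
      qed
    qed
  qed
  have h: "(\<Sum>j=1..m. 1 / real j) \<le> 1 + ln (real m)" if "m \<ge> 1" for m
    using that
  proof (induction m rule: dec_induct)
    case (step m)
    have "1 / real (Suc m) \<le> ln (real (Suc m)) - ln (real m)"
      using ln_le_minus_one[of "real m / real (Suc m)"] step by (simp add: ln_div field_simps)
    then show ?case using step by simp
  qed simp
  have "(\<Sum>j=1..(w-1) div 2. 1 / real (2 * j)) = (\<Sum>j=1..(w-1) div 2. 1 / real j) / 2"
    by (simp add: sum_divide_distrib mult.commute)
  also have "\<dots> \<le> (1 + ln (real w)) / 2"
  proof -
    have "(\<Sum>j=1..(w-1) div 2. 1 / real j) \<le> (\<Sum>j=1..w. 1 / real j)"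
      by (intro sum_mono2) auto
    then show ?thesis using h[of w] assms by simp
  qed
  finally show ?thesis using *[of "w - 1"] assms by (simp add: add_divide_distrib)
qed

lemma prime_reciprocals_unbounded:
  "\<exists>v. L \<le> (\<Sum>p | prime p \<and> u < p \<and> p \<le> v. 1 / real p)"
proof -
  let ?U = "\<Sum>p | prime p \<and> p \<le> u. 1 / real p"
  have "filterlim (\<lambda>z::nat. ln (ln (real z)) - 1) at_top at_top" by real_asymp
  then have "eventually (\<lambda>z::nat. L + ?U \<le> ln (ln (real z)) - 1) at_top"
    by (simp add: filterlim_at_top)
  then have "eventually (\<lambda>z. z \<ge> max 2 u \<and> L + ?U \<le> ln (ln (real z)) - 1) at_top"
    using eventually_ge_at_top by (rule eventually_conj[rotated])
  then obtain v where v: "v \<ge> 2" "v \<ge> u" "L + ?U \<le> ln (ln (real v)) - 1"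
    using eventually_happens[of _ sequentially] by fastforce
  have "{p. prime p \<and> p \<le> v} = {p. prime p \<and> p \<le> u} \<union> {p. prime p \<and> u < p \<and> p \<le> v}"
    using v by auto
  then have "(\<Sum>p | prime p \<and> p \<le> v. 1 / real p) = ?U + (\<Sum>p | prime p \<and> u < p \<and> p \<le> v. 1 / real p)"
    by (simp add: sum.union_disjoint[symmetric] disjoint_iff)
  then show ?thesis using prime_reciprocals_ge[OF v(1)] v(3) by (intro exI[of _ v]) linarith
qed

section \<open>Completely multiplicative functions with prescribed values at primes\<close>

text \<open>Taking an arbitrary \<open>F\<close> on \<open>nat\<close> lets the stages prescribe
  values on initial segments. At 0 the multiset is empty and the value is 1, so unimodularity holds
  for all arguments without side condition.\<close>

definition completely_mult :: "(nat \<Rightarrow> complex) \<Rightarrow> nat \<Rightarrow> complex" where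
  "completely_mult F n = (\<Prod>p\<in>#prime_factorization n. F p)"

lemma completely_mult_mult:
  assumes "m \<noteq> 0" "n \<noteq> 0"
  shows "completely_mult F (m * n) = completely_mult F m * completely_mult F n"
  using assms by (simp add: completely_mult_def prime_factorization_mult)

lemma completely_mult_prime:
  assumes "prime p"
  shows "completely_mult F p = F p"
  using assms by (simp add: completely_mult_def prime_factorization_prime)

lemma norm_completely_mult:
  assumes "\<And>p. norm (F p) = 1"
  shows "norm (completely_mult F n) = 1"
proof -
  have "norm (\<Prod>p\<in>#A. F p) = 1" for A
    by (induction A) (auto simp: norm_mult assms)
  then show ?thesis by (simp add: completely_mult_def)
qed

lemma completely_mult_bounded_multiplicative:
  assumes "\<And>p. norm (F p) = 1"
  shows "completely_mult F \<in> bounded_multiplicative"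
  using assms by (simp add: bounded_multiplicative_def completely_mult_mult norm_completely_mult)

section \<open>Cancellation from alternating signs on a block of primes\<close>

text \<open>A complex form of the alternating series test: the decrease of \<open>d\<close>
  dominates the variation of \<open>h\<close>, so differences of consecutive terms telescope, and a
  term left without a partner is bounded by \<open>d\<close> itself.\<close>

lemma norm_alternating_sum_le:
  fixes h :: "nat \<Rightarrow> complex" and d :: "nat \<Rightarrow> real"
  assumes "finite A" and "\<And>p. p \<in> A \<Longrightarrow> m < p" and "1 \<le> m"
    and diff: "\<And>p q. 1 \<le> p \<Longrightarrow> p \<le> q \<Longrightarrow> norm (h p - h q) \<le> d p - d q"
    and h: "\<And>p. norm (h p) \<le> d p"
  shows "norm (\<Sum>p\<in>A. (-1) ^ card {q\<in>A. q < p} * h p) \<le> d m"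
proof -
  define S where "S A = (\<Sum>p\<in>A. (-1) ^ card {q\<in>A. q < p} * h p)" for A
  \<comment> \<open>Adding a new minimum \<open>b\<close> turns \<open>S A\<close> into
    \<open>h b - S A\<close>, so the two bounds imply each other alternately and have to be proved
    together, for every \<open>m\<close> below the set.\<close>
  have "\<forall>m\<ge>1. (\<forall>p\<in>A. m < p) \<longrightarrow> norm (S A) \<le> d m \<and> norm (h m - S A) \<le> d m"
    using assms(1)
  proof (induction A rule: finite_linorder_min_induct)
    case empty
    have "0 \<le> d m" for m using norm_ge_zero[of "h m"] h[of m] by linarith
    then show ?case by (simp add: S_def h)
  next
    case (insert b A)
    have S: "S (insert b A) = h b - S A"
    proof -
      have b: "{q \<in> insert b A. q < b} = {}" using insert(2) by auto
      have "card {q \<in> insert b A. q < p} = Suc (card {q \<in> A. q < p})" if "p \<in> A" for p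
      proof -
        have "{q \<in> insert b A. q < p} = insert b {q \<in> A. q < p}" using insert(2) that by auto
        moreover have "b \<notin> {q \<in> A. q < p}" using insert(2) by auto
        ultimately show ?thesis using insert(1) by simp
      qed
      then have "(\<Sum>p\<in>A. (-1) ^ card {q \<in> insert b A. q < p} * h p) = - S A"
        unfolding S_def sum_negf[symmetric] by (intro sum.cong) auto
      moreover have "b \<notin> A" using insert(2) by auto
      ultimately show ?thesis unfolding S_def[of "insert b A"] sum.insert[OF insert(1) \<open>b \<notin> A\<close>] b
        by simp
    qed
    show ?case
    proof (intro allI impI)
      fix m assume m: "1 \<le> m" "\<forall>p\<in>insert b A. m < p"
      have 1: "norm (S (insert b A)) \<le> d b" "norm (S A) \<le> d b"
        using insert(2,3) m unfolding S by auto
      have "m \<le> b" using m(2) by (simp add: less_imp_le)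
      then have "d b \<le> d m" using diff[OF m(1), of b] norm_ge_zero[of "h m - h b"] by linarith
      moreover have "norm (h m - S (insert b A)) \<le> norm (h m - h b) + norm (S A)"
        using norm_triangle_ineq[of "h m - h b" "S A"] by (simp add: S diff_diff_eq2 diff_add_eq)
      moreover have "norm (h m - h b) \<le> d m - d b" using diff[of m b] m by simp
      ultimately show "norm (S (insert b A)) \<le> d m \<and> norm (h m - S (insert b A)) \<le> d m"
        using 1 by linarith
    qed
  qed
  then show ?thesis using assms(2,3) unfolding S_def by blast
qed

lemma card_multiples_upto:
  assumes "0 < d"
  shows "card {n\<in>{1..x}. d dvd n} = x div (d::nat)"
proof -
  have "{n\<in>{1..x}. d dvd n} = (*) d ` {1..x div d}"
  proof (intro equalityI subsetI)
    fix n assume "n \<in> {n\<in>{1..x}. d dvd n}"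
    then obtain m where "n = d * m" "1 \<le> n" "n \<le> x" by auto
    then show "n \<in> (*) d ` {1..x div d}" using assms
      by (auto simp: less_eq_div_iff_mult_less_eq mult.commute Suc_le_eq)
  qed (use assms in \<open>auto simp: less_eq_div_iff_mult_less_eq mult.commute Suc_le_eq\<close>)
  moreover have "inj_on ((*) d) {1..x div d}" using assms by (auto simp: inj_on_def)
  ultimately show ?thesis by (simp add: card_image)
qed

text \<open>When the square is expanded, the second moment is needed only from above, where rounding
  \<open>x div (p * q)\<close> down helps, and the mean only from below, where each prime loses at
  most 1. Hence the rounding error is linear in \<open>card P\<close>. The main terms x L^2 cancel,
  and the diagonal p = q leaves x L.\<close>

lemma turan_kubilius:
  assumes P: "finite P" "\<And>p. p \<in> P \<Longrightarrow> prime p"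
  defines "L \<equiv> \<Sum>p\<in>P. 1 / real p"
  shows "(\<Sum>n=1..x. (real (card {p\<in>P. p dvd n}) - L)\<^sup>2) \<le> real x * L + 2 * L * real (card P)"
proof -
  define e :: "nat \<Rightarrow> nat \<Rightarrow> real" where "e d n = of_bool (d dvd n)" for d n
  have w: "real (card {p\<in>P. p dvd n}) = (\<Sum>p\<in>P. e p n)" for n
  proof -
    have "(\<Sum>p\<in>P. e p n) = (\<Sum>p\<in>P. if p dvd n then 1 else 0)" by (simp add: e_def of_bool_def)
    also have "\<dots> = real (card {p\<in>P. p dvd n})" using P(1) by (simp add: sum.If_cases Int_def)
    finally show ?thesis ..
  qed
  have cnt: "(\<Sum>n=1..x. e d n) = real (x div d)" if "0 < d" for d
  proof -
    have "(\<Sum>n=1..x. e d n) = (\<Sum>n=1..x. if d dvd n then 1 else 0)" by (simp add: e_def of_bool_def)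
    also have "\<dots> = real (card {n\<in>{1..x}. d dvd n})" by (simp add: sum.If_cases Int_def)
    finally show ?thesis using card_multiples_upto[OF that, of x] by simp
  qed
  have pos: "0 < p" if "p \<in> P" for p using P(2)[OF that] prime_gt_0_nat by blast
  have div_le: "real (x div d) \<le> real x / real d" for d
    using of_nat_div_le_of_nat by blast
  have L0: "0 \<le> L" unfolding L_def by (intro sum_nonneg) simp
  have "(\<Sum>n=1..x. (\<Sum>p\<in>P. e p n)\<^sup>2) = (\<Sum>p\<in>P. \<Sum>q\<in>P. \<Sum>n=1..x. e p n * e q n)"
    unfolding power2_eq_square sum_product
    by (subst sum.swap) (intro sum.cong refl sum.swap)
  also have "\<dots> \<le> (\<Sum>p\<in>P. \<Sum>q\<in>P. real x * (1 / real p * (1 / real q)) + (if q = p then real x / real p else 0))"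
  proof (intro sum_mono)
    fix p q assume pq: "p \<in> P" "q \<in> P"
    show "(\<Sum>n=1..x. e p n * e q n) \<le> real x * (1 / real p * (1 / real q)) + (if q = p then real x / real p else 0)"
    proof (cases "q = p")
      case True
      then have "(\<Sum>n=1..x. e p n * e q n) = (\<Sum>n=1..x. e p n)" by (simp add: e_def)
      also have "\<dots> \<le> real x / real p" using cnt[OF pos[OF pq(1)]] div_le by simp
      finally show ?thesis using True by (simp add: add_increasing)
    next
      case False
      then have "coprime p q" using P(2) pq primes_coprime by blast
      then have "e p n * e q n = e (p * q) n" for n
        by (auto simp: e_def intro: divides_mult dvd_mult_left dvd_mult_right)
      then have "(\<Sum>n=1..x. e p n * e q n) = real (x div (p * q))" using cnt pos pq by simp
      also have "\<dots> \<le> real x / real (p * q)" by (rule div_le)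
      finally show ?thesis using False by simp
    qed
  qed
  also have "\<dots> = real x * L\<^sup>2 + real x * L"
  proof -
    have "(\<Sum>p\<in>P. \<Sum>q\<in>P. real x * (1 / real p * (1 / real q))) = real x * L\<^sup>2"
      unfolding L_def power2_eq_square sum_product by (simp add: sum_distrib_left)
    moreover have "(\<Sum>p\<in>P. \<Sum>q\<in>P. if q = p then real x / real p else 0) = real x * L"
      using P(1) by (simp add: L_def sum_distrib_left)
    ultimately show ?thesis by (simp only: sum.distrib)
  qed
  finally have A: "(\<Sum>n=1..x. (\<Sum>p\<in>P. e p n)\<^sup>2) \<le> real x * L\<^sup>2 + real x * L" .
  have "(\<Sum>n=1..x. \<Sum>p\<in>P. e p n) = (\<Sum>p\<in>P. real (x div p))"
    using cnt pos by (subst sum.swap) simp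
  also have "\<dots> \<ge> (\<Sum>p\<in>P. real x * (1 / real p) - 1)"
  proof (intro sum_mono)
    fix p assume "p \<in> P"
    then have "0 < p" by (rule pos)
    then have "real x < (real (x div p) + 1) * real p"
      using dividend_less_div_times[of p x] by (simp flip: of_nat_mult of_nat_add of_nat_less_iff add: algebra_simps)
    then show "real x * (1 / real p) - 1 \<le> real (x div p)"
      using \<open>0 < p\<close> by (simp add: field_simps)
  qed
  also have "(\<Sum>p\<in>P. real x * (1 / real p) - 1) = real x * L - real (card P)"
    unfolding L_def by (simp add: sum_subtractf sum_distrib_left)
  finally have B: "real x * L - real (card P) \<le> (\<Sum>n=1..x. \<Sum>p\<in>P. e p n)" .
  have "(\<Sum>n=1..x. (real (card {p\<in>P. p dvd n}) - L)\<^sup>2) =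
      (\<Sum>n=1..x. (\<Sum>p\<in>P. e p n)\<^sup>2) - 2 * L * (\<Sum>n=1..x. \<Sum>p\<in>P. e p n) + real x * L\<^sup>2"
    unfolding w power2_diff by (simp add: sum.distrib sum_subtractf sum_distrib_left mult_ac)
  also have "\<dots> \<le> (real x * L\<^sup>2 + real x * L) - 2 * L * (real x * L - real (card P)) + real x * L\<^sup>2"
    using A mult_left_mono[OF B, of "2 * L"] L0 by linarith
  also have "\<dots> = real x * L + 2 * L * real (card P)"
    by (simp add: power2_eq_square algebra_simps)
  finally show ?thesis .
qed

text \<open>By Turan-Kubilius, \<open>L\<close> times the sum is close to the sum weighted with the number of prime
  factors in \<open>P\<close>. Writing \<open>n = p * m\<close>, the inner sum over \<open>m\<close> depends only on \<open>p mod D\<close> and changes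
  slowly with \<open>x div p\<close>, so it telescopes against the alternating signs. The values of \<open>F\<close> at primes
  outside \<open>P\<close> play no role.\<close>
lemma alternating_block_cancellation:
  assumes P: "finite P" "\<And>p. p \<in> P \<Longrightarrow> prime p \<and> u < p" and u: "1 \<le> u"
    and F: "\<And>p. norm (F p) = 1"
    and alt: "\<And>p. p \<in> P \<Longrightarrow> F p = (-1) ^ card {q\<in>P. q mod D = p mod D \<and> q < p}"
    and D: "0 < D" "a dvd D" and x: "2 * card P \<le> x"
  defines "L \<equiv> \<Sum>p\<in>P. 1 / real p"
  shows "L * norm (\<Sum>n | n \<in> {1..x} \<and> [n = b] (mod a). completely_mult F n)
           \<le> real x * sqrt (2 * L) + real D * (real x / real u)"
proof -
  define g where "g = completely_mult F"
  define N where "N = {n. n \<in> {1..x} \<and> [n = b] (mod a)}"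
  define w where "w n = card {p\<in>P. p dvd n}" for n
  define H where "H c y = (\<Sum>m | m \<in> {1..y} \<and> [c * m = b] (mod a). g m)" for c y
  have g1: "norm (g n) = 1" for n unfolding g_def by (rule norm_completely_mult[OF F])
  have L0: "0 \<le> L" unfolding L_def by (intro sum_nonneg) simp
  have finN: "finite N" "N \<subseteq> {1..x}" unfolding N_def by auto
  have "norm (\<Sum>n\<in>N. g n * of_real (L - real (w n))) \<le> (\<Sum>n\<in>N. \<bar>L - real (w n)\<bar>)"
    by (rule order_trans[OF norm_sum]) (simp add: norm_mult g1 del: of_real_diff)
  also have "\<dots> \<le> (\<Sum>n=1..x. \<bar>L - real (w n)\<bar>)"
    using finN by (intro sum_mono2) auto
  also have "\<dots> \<le> sqrt (real x * (\<Sum>n=1..x. (real (w n) - L)\<^sup>2))"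
  proof (rule real_le_rsqrt)
    have "(\<Sum>n=1..x. 1 * \<bar>L - real (w n)\<bar>)\<^sup>2 \<le> (\<Sum>n=1..x. 1\<^sup>2) * (\<Sum>n=1..x. \<bar>L - real (w n)\<bar>\<^sup>2)"
      by (rule Cauchy_Schwarz_ineq_sum)
    then show "(\<Sum>n=1..x. \<bar>L - real (w n)\<bar>)\<^sup>2 \<le> real x * (\<Sum>n=1..x. (real (w n) - L)\<^sup>2)"
      by (simp add: power2_commute)
  qed
  also have "\<dots> \<le> sqrt ((real x)\<^sup>2 * (2 * L))"
  proof (rule real_sqrt_le_mono)
    have "(\<Sum>n=1..x. (real (w n) - L)\<^sup>2) \<le> real x * L + 2 * L * real (card P)"
      unfolding w_def L_def by (rule turan_kubilius) (use P in auto)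
    \<comment> \<open>The assumption that \<open>x\<close> is at least twice \<open>card P\<close>
      turns the rounding term into a second copy of the diagonal term; this is the 2 under the
      square root.\<close>
    also have "\<dots> \<le> real x * L + L * real x"
    proof -
      have "2 * real (card P) \<le> real x" using x by (simp flip: of_nat_mult of_nat_le_iff)
      then show ?thesis using mult_left_mono[OF _ L0, of "2 * real (card P)" "real x"] by simp
    qed
    finally have "(\<Sum>n=1..x. (real (w n) - L)\<^sup>2) \<le> real x * (2 * L)" by (simp add: algebra_simps)
    from mult_left_mono[OF this, of "real x"]
    show "real x * (\<Sum>n=1..x. (real (w n) - L)\<^sup>2) \<le> (real x)\<^sup>2 * (2 * L)"
      by (simp add: power2_eq_square mult.assoc)
  qed
  also have "\<dots> = real x * sqrt (2 * L)" by (simp add: real_sqrt_mult)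
  finally have first: "norm (\<Sum>n\<in>N. g n * of_real (L - real (w n))) \<le> real x * sqrt (2 * L)" .

  \<comment> \<open>The summands are unimodular, so partial sums move no faster than their length.
    With \<open>y' = 0\<close> this also bounds \<open>H\<close> itself.\<close>
  have Hdiff: "norm (H c y - H c y') \<le> real y - real y'" if "y' \<le> y" for c y y'
  proof -
    have "H c y - H c y' = (\<Sum>m | m \<in> {y'<..y} \<and> [c * m = b] (mod a). g m)"
      unfolding H_def using that
      by (subst sum_diff[symmetric]) (auto intro!: sum.cong)
    also have "norm \<dots> \<le> (\<Sum>m | m \<in> {y'<..y} \<and> [c * m = b] (mod a). 1)"
      by (rule order_trans[OF norm_sum]) (simp add: g1)
    also have "\<dots> \<le> (\<Sum>m\<in>{y'<..y}. 1)" by (intro sum_mono2) auto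
    finally show ?thesis using that by (simp add: of_nat_diff)
  qed
  have "(\<Sum>n\<in>N. g n * of_real (real (w n))) = (\<Sum>n\<in>N. \<Sum>p\<in>P. if p dvd n then g n else 0)"
    using P(1) by (intro sum.cong refl) (simp add: w_def sum.If_cases Int_def mult.commute)
  also have "\<dots> = (\<Sum>p\<in>P. \<Sum>n\<in>N. if p dvd n then g n else 0)" by (rule sum.swap)
  also have "\<dots> = (\<Sum>p\<in>P. F p * H (p mod D) (x div p))"
  proof (intro sum.cong refl)
    fix p assume p: "p \<in> P"
    have p0: "prime p" "0 < p" using P(2)[OF p] by (auto simp: prime_gt_0_nat)
    have cong: "[(p mod D) * m = b] (mod a) \<longleftrightarrow> [p * m = b] (mod a)" for m
    proof -
      have "[p mod D = p] (mod a)" using D(2) by (simp add: cong_def mod_mod_cancel)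
      then have "[(p mod D) * m = p * m] (mod a)" by (rule cong_scalar_right)
      then show ?thesis using cong_trans cong_sym by blast
    qed
    have "(\<Sum>n\<in>N. if p dvd n then g n else 0) = (\<Sum>n | n \<in> N \<and> p dvd n. g n)"
      using finN by (simp add: sum.If_cases Int_def)
    also have "\<dots> = (\<Sum>m | m \<in> {1..x div p} \<and> [(p mod D) * m = b] (mod a). g (p * m))"
    proof (rule sum.reindex_bij_witness[of _ "\<lambda>m. p * m" "\<lambda>n. n div p"])
      fix n assume "n \<in> {n. n \<in> N \<and> p dvd n}"
      then show "n div p \<in> {m. m \<in> {1..x div p} \<and> [(p mod D) * m = b] (mod a)}"
        "p * (n div p) = n" "g (p * (n div p)) = g n"
        using p0 unfolding cong N_def by (auto simp: div_le_mono Suc_le_eq elim!: dvdE)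
    next
      fix m assume "m \<in> {m. m \<in> {1..x div p} \<and> [(p mod D) * m = b] (mod a)}"
      then show "p * m \<in> {n. n \<in> N \<and> p dvd n}" "p * m div p = m"
        using p0 unfolding cong N_def by (auto simp: less_eq_div_iff_mult_less_eq mult.commute Suc_le_eq)
    qed
    also have "\<dots> = (\<Sum>m | m \<in> {1..x div p} \<and> [(p mod D) * m = b] (mod a). F p * g m)"
      using p0 by (intro sum.cong refl) (auto simp: g_def completely_mult_mult completely_mult_prime)
    finally show "(\<Sum>n\<in>N. if p dvd n then g n else 0) = F p * H (p mod D) (x div p)"
      unfolding H_def by (simp add: sum_distrib_left)
  qed
  also have "\<dots> = (\<Sum>c<D. \<Sum>p | p \<in> P \<and> p mod D = c. F p * H (p mod D) (x div p))"
    using P(1) D(1) by (subst sum.group[symmetric, of _ "{..<D}" "\<lambda>p. p mod D"]) auto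
  finally have eq: "(\<Sum>n\<in>N. g n * of_real (real (w n))) =
      (\<Sum>c<D. \<Sum>p | p \<in> P \<and> p mod D = c. F p * H (p mod D) (x div p))" .
  have second: "norm (\<Sum>n\<in>N. g n * of_real (real (w n))) \<le> real D * (real x / real u)"
    unfolding eq
  proof (rule order_trans[OF norm_sum])
    have "norm (\<Sum>p | p \<in> P \<and> p mod D = c. F p * H (p mod D) (x div p)) \<le> real x / real u" for c
    proof -
      define A where "A = {p \<in> P. p mod D = c}"
      have "(\<Sum>p | p \<in> P \<and> p mod D = c. F p * H (p mod D) (x div p)) =
          (\<Sum>p\<in>A. (-1) ^ card {q\<in>A. q < p} * H c (x div p))"
        unfolding A_def by (intro sum.cong refl) (auto simp: alt conj_assoc)
      also have "norm \<dots> \<le> real (x div u)"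
      \<comment> \<open>All primes of the class exceed \<open>u\<close>, so the bound is
        \<open>d u = x div u\<close>, and it is paid once for each of the \<open>D\<close> residue
        classes.\<close>
      proof (rule norm_alternating_sum_le[where d = "\<lambda>p. real (x div p)" and h = "\<lambda>p. H c (x div p)"])
        show "finite A" "\<And>p. p \<in> A \<Longrightarrow> u < p" using P by (auto simp: A_def)
        show "norm (H c (x div p) - H c (x div q)) \<le> real (x div p) - real (x div q)"
          if "1 \<le> p" "p \<le> q" for p q
          using that by (intro Hdiff div_le_mono2) auto
        show "norm (H c (x div p)) \<le> real (x div p)" for p
          using Hdiff[of 0 "x div p" c] by (simp add: H_def)
      qed (use u in simp)
      also have "\<dots> \<le> real x / real u" using of_nat_div_le_of_nat by blast
      finally show ?thesis .
    qed
    then have "(\<Sum>c<D. norm (\<Sum>p | p \<in> P \<and> p mod D = c. F p * H (p mod D) (x div p)))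
        \<le> (\<Sum>c<D. real x / real u)" by (intro sum_mono)
    then show "(\<Sum>c<D. norm (\<Sum>p | p \<in> P \<and> p mod D = c. F p * H (p mod D) (x div p)))
        \<le> real D * (real x / real u)" by simp
  qed
  have "of_real L * (\<Sum>n\<in>N. g n) = (\<Sum>n\<in>N. g n * of_real (L - real (w n))) + (\<Sum>n\<in>N. g n * of_real (real (w n)))"
    by (simp add: sum_distrib_left sum.distrib[symmetric] algebra_simps)
  then have "norm (of_real L * (\<Sum>n\<in>N. g n)) \<le> real x * sqrt (2 * L) + real D * (real x / real u)"
    using norm_triangle_mono[OF first second] by simp
  then show ?thesis using L0 unfolding g_def N_def by (simp add: norm_mult)
qed

section \<open>Greedy balancing of signs\<close>

text \<open>This says cosh x \<le> exp (x^2), the bound for the exponential moment of a random sign.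
  For 0 \<le> y \<le> 1 it comes from exp y \<le> 1 + y + y^2 and 1 / (1 + y) \<le> 1 - y + y^2,
  whose linear terms cancel.\<close>

lemma exp_add_exp_minus_le:
  fixes x :: real
  assumes "\<bar>x\<bar> \<le> 1"
  shows "exp x + exp (- x) \<le> 2 * exp (x\<^sup>2)"
proof -
  have *: "exp y + exp (- y) \<le> 2 * exp (y\<^sup>2)" if y: "0 \<le> y" "y \<le> 1" for y :: real
  proof -
    have "exp (- y) \<le> 1 / (1 + y)"
      using exp_ge_add_one_self[of y] y by (simp add: exp_minus field_simps)
    also have "\<dots> \<le> 1 - y + y\<^sup>2"
      using y by (simp add: field_simps power2_eq_square power3_eq_cube)
    finally have "exp y + exp (- y) \<le> 2 * (1 + y\<^sup>2)" using exp_bound[OF y] by simp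
    also have "\<dots> \<le> 2 * exp (y\<^sup>2)" by (intro mult_left_mono exp_ge_add_one_self) simp
    finally show ?thesis .
  qed
  show ?thesis using *[of "\<bar>x\<bar>"] assms by (cases "0 \<le> x") (auto simp: add.commute)
qed

text \<open>Greedy choice of the signs: at each step one of the two signs multiplies the exponential
  potential by at most \<open>exp ((c p)\<^sup>2)\<close>.\<close>
lemma exists_balancing_signs:
  fixes a :: "'i \<Rightarrow> nat \<Rightarrow> real"
  assumes "finite P" "finite I" "\<And>i p. i \<in> I \<Longrightarrow> p \<in> P \<Longrightarrow> \<bar>a i p\<bar> \<le> c p" "\<And>p. p \<in> P \<Longrightarrow> c p \<le> 1"
  shows "\<exists>e :: nat \<Rightarrow> real. (\<forall>p. e p = 1 \<or> e p = -1) \<and>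
           (\<Sum>i\<in>I. exp (\<Sum>p\<in>P. e p * a i p)) \<le> real (card I) * exp (\<Sum>p\<in>P. (c p)\<^sup>2)"
  using assms(1,3,4)
proof (induction P rule: finite_induct)
  case empty
  show ?case by (intro exI[of _ "\<lambda>_. 1"]) simp
next
  case (insert p P)
  then obtain e where e: "\<And>p. e p = 1 \<or> e p = (-1 :: real)"
    "(\<Sum>i\<in>I. exp (\<Sum>p\<in>P. e p * a i p)) \<le> real (card I) * exp (\<Sum>p\<in>P. (c p)\<^sup>2)"
    by auto
  define E where "E i = exp (\<Sum>p\<in>P. e p * a i p)" for i
  define S where "S s = (\<Sum>i\<in>I. E i * exp (s * a i p))" for s
  have S: "(\<Sum>i\<in>I. exp (\<Sum>q\<in>insert p P. (e(p := s)) q * a i q)) = S s" for s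
  proof -
    have "(\<Sum>q\<in>P. (e(p := s)) q * a i q) = (\<Sum>q\<in>P. e q * a i q)" for i
      using insert.hyps(2) by (intro sum.cong refl) auto
    then show ?thesis using insert.hyps unfolding S_def E_def
      by (simp add: exp_add mult.commute)
  qed
  have "S 1 + S (-1) = (\<Sum>i\<in>I. E i * (exp (a i p) + exp (- a i p)))"
    unfolding S_def by (simp add: sum.distrib distrib_left)
  also have "\<dots> \<le> (\<Sum>i\<in>I. E i * (2 * exp ((c p)\<^sup>2)))"
  proof (intro sum_mono mult_left_mono)
    fix i assume i: "i \<in> I"
    have b: "\<bar>a i p\<bar> \<le> c p" "c p \<le> 1" using insert.prems i by auto
    have "exp (a i p) + exp (- a i p) \<le> 2 * exp ((a i p)\<^sup>2)"
      by (rule exp_add_exp_minus_le) (use b in linarith)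
    also have "(a i p)\<^sup>2 \<le> (c p)\<^sup>2" using b by (intro abs_le_square_iff[THEN iffD1]) linarith
    finally show "exp (a i p) + exp (- a i p) \<le> 2 * exp ((c p)\<^sup>2)" by simp
  qed (simp add: E_def)
  also have "\<dots> = 2 * exp ((c p)\<^sup>2) * (\<Sum>i\<in>I. E i)" unfolding sum_distrib_left by (simp add: mult_ac)
  also have "\<dots> \<le> 2 * exp ((c p)\<^sup>2) * (real (card I) * exp (\<Sum>p\<in>P. (c p)\<^sup>2))"
    using e(2) unfolding E_def by (intro mult_left_mono) auto
  also have "\<dots> = 2 * (real (card I) * exp (\<Sum>q\<in>insert p P. (c q)\<^sup>2))"
    using insert.hyps by (simp add: exp_add)
  finally have "S 1 \<le> real (card I) * exp (\<Sum>q\<in>insert p P. (c q)\<^sup>2) \<or>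
      S (-1) \<le> real (card I) * exp (\<Sum>q\<in>insert p P. (c q)\<^sup>2)" by linarith
  then obtain s :: real where s: "s = 1 \<or> s = -1"
    "S s \<le> real (card I) * exp (\<Sum>q\<in>insert p P. (c q)\<^sup>2)" by blast
  then show ?case using e(1) S[of s] by (intro exI[of _ "e(p := s)"]) auto
qed

section \<open>Orthogonality and number of Dirichlet characters\<close>

lemma norm_dirichlet_character_eq_1:
  assumes "dirichlet_character q chi" "1 \<le> q" "coprime n q"
  shows "norm (chi n) = 1"
proof -
  have "norm (chi n) ^ totient q = 1"
    using dirichlet_character_root_of_unity[OF assms(1,3)] by (simp flip: norm_power)
  moreover have "totient q > 0" using assms(2) by simp
  ultimately show ?thesis using power_eq_1_iff[of "norm (chi n)" "totient q"] by simp
qed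

lemma dirichlet_character_orthogonality:
  assumes chi: "dirichlet_character q chi" and psi: "dirichlet_character q psi"
    and q: "1 \<le> q" and "chi \<noteq> psi"
  shows "(\<Sum>n<q. chi n * cnj (psi n)) = 0"
proof -
  obtain a where a: "chi a \<noteq> psi a" using assms(4) by blast
  have cop: "coprime a q"
  proof (rule ccontr)
    assume "\<not> coprime a q"
    then have "chi a = 0" "psi a = 0" using chi psi unfolding dirichlet_character_def by blast+
    then show False using a by simp
  qed
  define S where "S = (\<Sum>n<q. chi n * cnj (psi n))"
  have inj: "inj_on (\<lambda>n. a * n mod q) {..<q}"
  proof (rule inj_onI)
    fix m n assume mn: "m \<in> {..<q}" "n \<in> {..<q}" "a * m mod q = a * n mod q"
    then have "[a * m = a * n] (mod q)" by (simp add: cong_def)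
    then have "[m = n] (mod q)" using cong_mult_lcancel_nat[OF cop] by blast
    then show "m = n" using mn by (simp add: cong_def)
  qed
  moreover have "(\<lambda>n. a * n mod q) ` {..<q} \<subseteq> {..<q}" using q by auto
  ultimately have bij: "bij_betw (\<lambda>n. a * n mod q) {..<q} {..<q}"
    by (simp add: bij_betw_def endo_inj_surj)
  have "S = (\<Sum>n<q. chi (a * n mod q) * cnj (psi (a * n mod q)))"
    unfolding S_def by (rule sum.reindex_bij_betw[OF bij, symmetric])
  also have "\<dots> = (\<Sum>n<q. (chi a * cnj (psi a)) * (chi n * cnj (psi n)))"
    using chi psi unfolding dirichlet_character_mod[OF chi] dirichlet_character_mod[OF psi]
    by (intro sum.cong refl) (simp add: dirichlet_character_def)
  also have "\<dots> = chi a * cnj (psi a) * S" by (simp add: S_def sum_distrib_left)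
  finally have "(chi a * cnj (psi a) - 1) * S = 0" by (simp add: algebra_simps)
  moreover have "chi a * cnj (psi a) \<noteq> 1"
  proof
    assume 1: "chi a * cnj (psi a) = 1"
    have "psi a * cnj (psi a) = 1"
      using norm_dirichlet_character_eq_1[OF psi q cop] by (simp add: complex_norm_square[symmetric])
    then have "chi a = chi a * (psi a * cnj (psi a))" by simp
    also have "\<dots> = psi a * (chi a * cnj (psi a))" by (simp add: mult_ac)
    finally show False using 1 a by simp
  qed
  ultimately show ?thesis by (simp add: S_def)
qed

lemma card_dirichlet_character_le:
  assumes q: "1 \<le> q"
  shows "card {chi. dirichlet_character q chi} \<le> q"
proof -
  define X where "X = {chi. dirichlet_character q chi}"
  \<comment> \<open>Orthogonality evaluates the mean square of \<open>S\<close>, which dominates its value at 1, the square of \<open>card X\<close>.\<close>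
  define S where "S n = (\<Sum>chi\<in>X. chi n)" for n
  have fin: "finite X" unfolding X_def by (rule finite_dirichlet_character[OF q])
  have "(\<Sum>n<q. S n * cnj (S n)) = (\<Sum>chi\<in>X. \<Sum>psi\<in>X. \<Sum>n<q. chi n * cnj (psi n))"
    unfolding S_def cnj_sum sum_product
    by (subst sum.swap) (intro sum.cong refl sum.swap)
  also have "\<dots> = (\<Sum>chi\<in>X. \<Sum>psi\<in>X. if psi = chi then \<Sum>n<q. chi n * cnj (chi n) else 0)"
    using q by (intro sum.cong refl) (auto simp: X_def dirichlet_character_orthogonality)
  also have "\<dots> = (\<Sum>chi\<in>X. \<Sum>n<q. chi n * cnj (chi n))" using fin by simp
  finally have "complex_of_real (\<Sum>n<q. (norm (S n))\<^sup>2) = complex_of_real (\<Sum>chi\<in>X. \<Sum>n<q. (norm (chi n))\<^sup>2)"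
    by (simp only: of_real_sum complex_norm_square)
  then have eq: "(\<Sum>n<q. (norm (S n))\<^sup>2) = (\<Sum>chi\<in>X. \<Sum>n<q. (norm (chi n))\<^sup>2)"
    by (simp only: of_real_eq_iff)
  have "S (1 mod q) = (\<Sum>chi\<in>X. 1)"
    unfolding S_def using dirichlet_character_mod dirichlet_character_one
    by (intro sum.cong refl) (metis X_def mem_Collect_eq)
  then have "(real (card X))\<^sup>2 = (norm (S (1 mod q)))\<^sup>2" by simp
  also have "\<dots> \<le> (\<Sum>n<q. (norm (S n))\<^sup>2)"
    using q by (intro member_le_sum) auto
  also have "\<dots> \<le> (\<Sum>chi\<in>X. \<Sum>n<q. 1)"
    unfolding eq
  proof (intro sum_mono)
    fix chi n assume "chi \<in> X"
    then have "norm (chi n) \<le> 1" using norm_dirichlet_character_le q unfolding X_def by blast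
    then show "(norm (chi n))\<^sup>2 \<le> 1" by (simp add: power_le_one)
  qed
  finally have "real (card X) * real (card X) \<le> real (card X) * real q" by (simp add: power2_eq_square)
  then show ?thesis unfolding X_def[symmetric] by (cases "card X = 0") auto
qed

text \<open>The count enters the later argument only through the logarithm of the size of the net of
  twists, so at most \<open>q\<close> characters for each modulus \<open>q\<close> is accurate
  enough.\<close>

lemma card_characters_upto_le:
  assumes "0 \<le> Q"
  shows "real (card (characters_upto Q)) \<le> Q\<^sup>2"
proof -
  let ?n = "nat \<lfloor>Q\<rfloor>"
  have "characters_upto Q \<subseteq> (\<Union>q\<in>{1..?n}. {chi. dirichlet_character q chi})"
    unfolding characters_upto_def by (force simp: le_nat_floor)
  then have "card (characters_upto Q) \<le> card (\<Union>q\<in>{1..?n}. {chi. dirichlet_character q chi})"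
    by (intro card_mono finite_UN_I finite_dirichlet_character) auto
  also have "\<dots> \<le> (\<Sum>q\<in>{1..?n}. card {chi. dirichlet_character q chi})"
    by (rule card_UN_le) simp
  also have "\<dots> \<le> (\<Sum>q\<in>{1..?n}. ?n)"
    by (intro sum_mono) (use card_dirichlet_character_le in fastforce)
  finally have "card (characters_upto Q) \<le> ?n * ?n" by simp
  then have "real (card (characters_upto Q)) \<le> real ?n * real ?n" by (simp flip: of_nat_mult)
  also have "\<dots> \<le> Q * Q" using assms by (intro mult_mono) (auto simp: of_nat_floor)
  finally show ?thesis by (simp add: power2_eq_square)
qed

section \<open>Imaginary powers and Kronecker's theorem for logarithms of primes\<close>

lemma natural_powr_imaginary:
  assumes "0 < n"
  shows "of_nat n powr (\<i> * of_real t) = cis (t * ln (real n))"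
  using assms by (simp add: powr_def cis_conv_exp Ln_of_nat mult.assoc)

lemma norm_cis_minus_one_le: "norm (cis x - 1) \<le> \<bar>x\<bar>"
proof (rule power2_le_imp_le)
  have "(norm (cis x - 1))\<^sup>2 = 2 - 2 * cos x"
    unfolding cmod_power2 using sin_cos_squared_add[of x] by (simp add: power2_eq_square algebra_simps)
  also have "\<dots> = 4 * (sin (x / 2))\<^sup>2"
    using cos_double_sin[of "x / 2"] by simp
  also have "\<dots> \<le> 4 * (x / 2)\<^sup>2"
    using abs_sin_x_le_abs_x[of "x / 2"] abs_le_square_iff[of "sin (x / 2)" "x / 2"] by linarith
  finally show "(norm (cis x - 1))\<^sup>2 \<le> \<bar>x\<bar>\<^sup>2" by (simp add: power2_eq_square)
qed simp

text \<open>Unique factorization: with the negative coefficients moved to the other side, a linear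
  relation equates two products of prime powers, and comparing the multiplicity of \<open>q\<close>
  gives the claim.\<close>

lemma prime_logs_independent:
  fixes r :: "nat \<Rightarrow> int"
  assumes P: "finite P" "\<And>p. p \<in> P \<Longrightarrow> prime p"
    and 0: "(\<Sum>p\<in>P. of_int (r p) * ln (real p)) = 0" and q: "q \<in> P"
  shows "r q = 0"
proof -
  define a where "a p = nat (r p)" for p
  define b where "b p = nat (- r p)" for p
  have pos: "0 < p" if "p \<in> P" for p using P(2)[OF that] by (rule prime_gt_0_nat)
  have ln_prod: "ln (real (\<Prod>p\<in>P. p ^ e p)) = (\<Sum>p\<in>P. real (e p) * ln (real p))" for e
  proof -
    have "ln (\<Prod>p\<in>P. real p ^ e p) = (\<Sum>p\<in>P. ln (real p ^ e p))"
      using pos P(1) by (intro ln_prod) auto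
    also have "\<dots> = (\<Sum>p\<in>P. real (e p) * ln (real p))"
      using pos by (intro sum.cong refl) (simp add: ln_realpow)
    finally show ?thesis by simp
  qed
  have "real (a p) - real (b p) = of_int (r p)" for p
    unfolding a_def b_def by (cases "0 \<le> r p") auto
  then have "(\<Sum>p\<in>P. real (a p) * ln (real p)) - (\<Sum>p\<in>P. real (b p) * ln (real p)) = 0"
    using 0 by (simp flip: sum_subtractf left_diff_distrib)
  then have "ln (real (\<Prod>p\<in>P. p ^ a p)) = ln (real (\<Prod>p\<in>P. p ^ b p))" by (simp only: ln_prod)
  moreover have "0 < (\<Prod>p\<in>P. p ^ e p)" for e
    using pos by (intro prod_pos) auto
  ultimately have "(\<Prod>p\<in>P. p ^ a p) = (\<Prod>p\<in>P. p ^ b p)"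
    by (metis ln_inj_iff of_nat_0_less_iff of_nat_eq_iff)
  then have "multiplicity q (\<Prod>p\<in>P. p ^ a p) = multiplicity q (\<Prod>p\<in>P. p ^ b p)" by simp
  then have "a q = b q"
    using P q by (simp add: multiplicity_prod_prime_powers)
  then show ?thesis unfolding a_def b_def by linarith
qed

text \<open>The angles \<open>t * ln p\<close> have to come close to \<open>- Arg (F p)\<close>
  modulo a full turn for finitely many primes at once. Measured in full turns, this is inhomogeneous
  approximation by real multiples of the numbers \<open>ln p / (2 * pi)\<close>, which are
  independent over the integers.\<close>

lemma kronecker_primes:
  assumes F: "\<And>p. norm (F p) = 1" and "0 < \<delta>"
  shows "\<exists>t. \<forall>p. prime p \<longrightarrow> p \<le> y \<longrightarrow> norm (F p * of_nat p powr (\<i> * of_real t) - 1) \<le> \<delta>"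
proof -
  define P where "P = {p. prime p \<and> p \<le> y}"
  have P: "finite P" "\<And>p. p \<in> P \<Longrightarrow> prime p" unfolding P_def by auto
  obtain e where e: "bij_betw e {..<card P} P"
    using ex_bij_betw_nat_finite[OF P(1)] by (auto simp: atLeast0LessThan)
  define \<theta> where "\<theta> i = ln (real (e i)) / (2 * pi)" for i
  have eP: "e i \<in> P" if "i < card P" for i using e that by (auto simp: bij_betw_def)
  have gt1: "1 < real (e i)" if "i < card P" for i
    using prime_gt_1_nat[OF P(2)[OF eP[OF that]]] by simp
  have inj: "inj_on \<theta> {..<card P}"
  proof (rule inj_onI)
    fix i j assume ij: "i \<in> {..<card P}" "j \<in> {..<card P}" "\<theta> i = \<theta> j"
    then have "ln (real (e i)) = ln (real (e j))" by (simp add: \<theta>_def)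
    then have "e i = e j" using gt1[of i] gt1[of j] ij by simp
    then show "i = j" using e ij by (auto simp: bij_betw_def inj_on_def)
  qed
  interpret Modules.module "(\<lambda>r. (*) (real_of_int r))"
    by (simp add: Modules.module.intro distrib_left mult.commute)
  have ind: "independent (\<theta> ` {..<card P})"
    unfolding independent_explicit_module
  proof (intro allI impI)
    fix T u v assume T: "finite T" "T \<subseteq> \<theta> ` {..<card P}" "(\<Sum>v\<in>T. real_of_int (u v) * v) = 0" "v \<in> T"
    \<comment> \<open>Independence concerns a set of reals. Since \<open>L\<close> is injective on
      primes, a relation among the values in \<open>T\<close> becomes one among the primes in
      \<open>S\<close>.\<close>
    define L where "L p = ln (real p) / (2 * pi)" for p :: nat
    define S where "S = {p\<in>P. L p \<in> T}"
    have injL: "inj_on L S"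
      using P(2) by (auto simp: inj_on_def L_def S_def prime_gt_0_nat)
    have "\<theta> ` {..<card P} = L ` e ` {..<card P}"
      unfolding \<theta>_def L_def image_image ..
    then have "\<theta> ` {..<card P} = L ` P" using e by (simp add: bij_betw_def)
    then have TS: "T = L ` S" using T(2) unfolding S_def by auto
    then have "(\<Sum>p\<in>S. real_of_int (u (L p)) * L p) = 0"
      using T(3) injL by (simp add: sum.reindex)
    then have "(\<Sum>p\<in>S. real_of_int (u (L p)) * ln (real p)) = 0"
      unfolding L_def by (simp flip: sum_divide_distrib)
    then have "u (L q) = 0" if "q \<in> S" for q
      using prime_logs_independent[of S "\<lambda>p. u (L p)" q] P that unfolding S_def by auto
    then show "u v = 0" using T(4) TS by auto
  qed
  have "0 < \<delta> / (2 * pi)" using assms(2) by simp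
  then obtain t h where th:
    "\<And>i. i < card P \<Longrightarrow> \<bar>t * \<theta> i - of_int (h i) - (- Arg (F (e i)) / (2 * pi))\<bar> < \<delta> / (2 * pi)"
    by (rule Kronecker_thm_1[OF ind inj, where \<alpha> = "\<lambda>i. - Arg (F (e i)) / (2 * pi)"]) blast
  have "norm (F p * of_nat p powr (\<i> * of_real t) - 1) \<le> \<delta>" if p: "prime p" "p \<le> y" for p
  proof -
    obtain i where i: "i < card P" "e i = p"
      using e p unfolding bij_betw_def P_def by (metis (mono_tags, lifting) imageE lessThan_iff mem_Collect_eq)
    define x where "x = Arg (F p) + t * ln (real p) - 2 * pi * of_int (h i)"
    have "F p = cis (Arg (F p))" using F[of p] cis_Arg[of "F p"] by (cases "F p = 0") (auto simp: sgn_eq)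
    then have "F p * of_nat p powr (\<i> * of_real t) = cis (Arg (F p)) * cis (t * ln (real p))"
      using natural_powr_imaginary[OF prime_gt_0_nat[OF p(1)], of t] by simp
    also have "\<dots> = cis x"
    proof -
      have "cis (2 * pi * of_int (h i)) = 1" by (rule cis_multiple_2pi) simp
      then show ?thesis by (simp add: x_def cis_mult flip: cis_divide)
    qed
    finally have "norm (F p * of_nat p powr (\<i> * of_real t) - 1) \<le> \<bar>x\<bar>"
      using norm_cis_minus_one_le by simp
    also have "x = 2 * pi * (t * \<theta> i - of_int (h i) - (- Arg (F (e i)) / (2 * pi)))"
      unfolding x_def \<theta>_def i(2) by (simp add: field_simps)
    also have "\<bar>\<dots>\<bar> \<le> 2 * pi * (\<delta> / (2 * pi))"
      unfolding abs_mult using th[OF i(1)] by (intro mult_mono) auto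
    finally show ?thesis by simp
  qed
  then show ?thesis by blast
qed

section \<open>Finite conditions and generic functions\<close>

text \<open>The finite conditions \<open>(F, y)\<close> fix a function on \<open>{..y}\<close>; a property is forced if all functions
  satisfying the condition have it.\<close>
definition forced :: "'a set \<Rightarrow> (nat \<Rightarrow> 'a) \<Rightarrow> nat \<Rightarrow> ((nat \<Rightarrow> 'a) \<Rightarrow> bool) \<Rightarrow> bool" where
  "forced A F y R \<longleftrightarrow> (\<forall>G. range G \<subseteq> A \<longrightarrow> (\<forall>p\<le>y. G p = F p) \<longrightarrow> R G)"

text \<open>In the product topology on functions from \<open>nat\<close> to a discrete space
  \<open>A\<close>, this says that the functions with property \<open>R\<close> contain a dense open
  set.\<close>

definition densely_forced :: "'a set \<Rightarrow> ((nat \<Rightarrow> 'a) \<Rightarrow> bool) \<Rightarrow> bool" where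
  "densely_forced A R \<longleftrightarrow> (\<forall>F y. range F \<subseteq> A \<longrightarrow>
     (\<exists>F' y'. range F' \<subseteq> A \<and> (\<forall>p\<le>y. F' p = F p) \<and> forced A F' y' R))"

lemma densely_forcedI:
  assumes "\<And>F y. range F \<subseteq> A \<Longrightarrow>
    \<exists>F' y'. range F' \<subseteq> A \<and> (\<forall>p\<le>y. F' p = F p) \<and> (\<forall>G. range G \<subseteq> A \<longrightarrow> (\<forall>p\<le>y'. G p = F' p) \<longrightarrow> R G)"
  shows "densely_forced A R"
  unfolding densely_forced_def forced_def by (intro allI impI assms)

lemma densely_forcedE:
  fixes F :: "nat \<Rightarrow> 'a"
  assumes "densely_forced A R" "range F \<subseteq> A"
  obtains F' :: "nat \<Rightarrow> 'a" and y' :: nat where "range F' \<subseteq> A" "\<And>p. p \<le> y \<Longrightarrow> F' p = F p" "y < y'" "forced A F' y' R"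
proof -
  obtain F' y' where *: "range F' \<subseteq> A" "\<And>p. p \<le> y \<Longrightarrow> F' p = F p" "forced A F' y' R"
    using assms unfolding densely_forced_def by blast
  \<comment> \<open>Fixing more values keeps a property forced. A bound beyond \<open>y\<close>
    makes the stages grow strictly, so that iterating them exhausts \<open>nat\<close>.\<close>
  then have "forced A F' (max y' (Suc y)) R" unfolding forced_def by simp
  then show ?thesis using that[of F' "max y' (Suc y)"] * by simp
qed

lemma densely_forced_conj:
  fixes A :: "'a set"
  assumes "densely_forced A R" "densely_forced A S"
  shows "densely_forced A (\<lambda>G. R G \<and> S G)"
proof (rule densely_forcedI)
  fix F :: "nat \<Rightarrow> 'a" and y
  assume F: "range F \<subseteq> A"
  obtain F1 y1 where 1: "range F1 \<subseteq> A" "\<And>p. p \<le> y \<Longrightarrow> F1 p = F p" "y < y1" "forced A F1 y1 R"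
    by (rule densely_forcedE[OF assms(1) F, of y]) blast
  obtain F2 y2 where 2: "range F2 \<subseteq> A" "\<And>p. p \<le> y1 \<Longrightarrow> F2 p = F1 p" "y1 < y2" "forced A F2 y2 S"
    by (rule densely_forcedE[OF assms(2) 1(1), of y1]) blast
  have "\<forall>p\<le>y. F2 p = F p" using 1 2 by simp
  moreover have "R G \<and> S G" if "range G \<subseteq> A" "\<forall>p\<le>y2. G p = F2 p" for G
    using that 1 2 unfolding forced_def by simp
  ultimately show "\<exists>F' y'. range F' \<subseteq> A \<and> (\<forall>p\<le>y. F' p = F p) \<and>
      (\<forall>G. range G \<subseteq> A \<longrightarrow> (\<forall>p\<le>y'. G p = F' p) \<longrightarrow> R G \<and> S G)"
    using 2(1) by blast
qed

text \<open>The Baire category theorem for functions from \<open>nat\<close> to \<open>A\<close>: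
  dependent choice yields conditions each extending the previous one, the n-th forcing
  \<open>R n\<close>, and their common extension satisfies all of them.\<close>

lemma generic_function_exists:
  assumes "A \<noteq> {}" and R: "\<And>n::nat. densely_forced A (R n)"
  shows "\<exists>G. range G \<subseteq> A \<and> (\<forall>n. R n G)"
proof -
  obtain a where a: "a \<in> A" using assms(1) by blast
  define Q where "Q n s s' \<longleftrightarrow> snd s < snd s' \<and> (\<forall>p\<le>snd s. fst s' p = fst s p) \<and> forced A (fst s') (snd s') (R n)"
    for n and s s' :: "(nat \<Rightarrow> 'a) \<times> nat"
  obtain s where s: "\<And>n. range (fst (s n)) \<subseteq> A" "\<And>n. Q n (s n) (s (Suc n))"
  proof -
    have "\<exists>s. \<forall>n. range (fst (s n)) \<subseteq> A \<and> Q n (s n) (s (Suc n))"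
    proof (rule dependent_nat_choice)
      show "\<exists>s :: (nat \<Rightarrow> 'a) \<times> nat. range (fst s) \<subseteq> A" using a by (intro exI[of _ "(\<lambda>_. a, 0)"]) auto
      fix s :: "(nat \<Rightarrow> 'a) \<times> nat" and n
      assume "range (fst s) \<subseteq> A"
      then obtain F' y' where "range F' \<subseteq> A" "\<And>p. p \<le> snd s \<Longrightarrow> F' p = fst s p" "snd s < y'" "forced A F' y' (R n)"
        by (rule densely_forcedE[OF R[of n], of _ "snd s"]) blast
      then show "\<exists>s'. range (fst s') \<subseteq> A \<and> Q n s s'"
        unfolding Q_def by (intro exI[of _ "(F', y')"]) simp
    qed
    then show ?thesis using that by blast
  qed
  have y: "n \<le> snd (s n)" for n
  proof (induction n)
    case (Suc n)
    then show ?case using s(2)[of n] by (simp add: Q_def)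
  qed simp
  have agree: "fst (s m) p = fst (s n) p" if "n \<le> m" "p \<le> snd (s n)" for m n p
  proof -
    have "fst (s m) p = fst (s n) p \<and> snd (s n) \<le> snd (s m)"
      using that(1)
    proof (induction m rule: dec_induct)
      case (step m)
      then show ?case using s(2)[of m] that(2) by (auto simp: Q_def)
    qed simp
    then show ?thesis ..
  qed
  \<comment> \<open>The diagonal is the limit of the stages: since \<open>p \<le> snd (s p)\<close>,
    stage \<open>p\<close> has fixed the value at \<open>p\<close> for good.\<close>
  define G where "G p = fst (s p) p" for p
  have G: "G p = fst (s n) p" if "p \<le> snd (s n)" for p n
    using agree[of p n p] agree[of n p p] y[of p] that unfolding G_def by (cases "p \<le> n") auto
  have "range G \<subseteq> A" using s(1) unfolding G_def by blast
  moreover from this have "R n G" for n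
    using s(2)[of n] G[of _ "Suc n"] unfolding Q_def forced_def by blast
  ultimately show ?thesis by blast
qed

section \<open>Cancellation in progressions and scales close to an imaginary power\<close>

abbreviation unit_circle :: "complex set" where "unit_circle \<equiv> {z. norm z = 1}"

text \<open>After division by \<open>L\<close>, the two errors of the block estimate are sqrt (2 /
  L) and D / (u L) times x. Requiring \<open>L\<close> to be at least 8 k^2 and \<open>u\<close> at
  least 2 k D makes each of them at most x / (2 k). The factorial \<open>D\<close> is a common
  multiple of all moduli up to \<open>k\<close>.\<close>

lemma densely_forced_progression_cancellation:
  assumes k: "1 \<le> k"
  shows "densely_forced unit_circle (\<lambda>G. \<forall>a\<in>{1..k}. \<forall>b. \<forall>\<^sub>F x in sequentially.
    norm (\<Sum>n | n \<in> {1..x} \<and> [n = b] (mod a). completely_mult G n) \<le> real x / real k)"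
proof (rule densely_forcedI)
  fix F :: "nat \<Rightarrow> complex" and y :: nat
  assume F: "range F \<subseteq> unit_circle"
  define D :: nat where "D = fact k"
  \<comment> \<open>The block starts above \<open>y\<close>, so the values already fixed stay
    untouched, and above 2 k D for the sake of the second error term.\<close>
  define u where "u = max y (2 * k * D)"
  obtain v where v: "8 * (real k)\<^sup>2 \<le> (\<Sum>p | prime p \<and> u < p \<and> p \<le> v. 1 / real p)"
    using prime_reciprocals_unbounded by blast
  define P where "P = {p. prime p \<and> u < p \<and> p \<le> v}"
  define L where "L = (\<Sum>p\<in>P. 1 / real p)"
  define F' where "F' p = (if p \<in> P then (-1) ^ card {q\<in>P. q mod D = p mod D \<and> q < p} else F p)" for p
  have P: "finite P" "\<And>p. p \<in> P \<Longrightarrow> prime p \<and> u < p" unfolding P_def by auto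
  have D: "0 < D" unfolding D_def by simp
  have u: "1 \<le> u" "2 * k * D \<le> u" unfolding u_def using k D by (auto simp: le_max_iff_disj Suc_le_eq)
  have L8: "8 * (real k)\<^sup>2 \<le> L" using v unfolding L_def P_def .
  have L1: "1 \<le> L" 
  proof -
    have "1 \<le> (real k)\<^sup>2" using k by simp
    then show ?thesis using L8 by linarith
  qed
  have range: "range F' \<subseteq> unit_circle"
    using F unfolding F'_def by (auto simp: norm_power)
  have agree: "F' p = F p" if "p \<le> y" for p using that unfolding F'_def P_def u_def by auto
  have cancel: "\<forall>\<^sub>F x in sequentially.
      norm (\<Sum>n | n \<in> {1..x} \<and> [n = b] (mod a). completely_mult G n) \<le> real x / real k"
    if G: "range G \<subseteq> unit_circle" "\<forall>p\<le>v. G p = F' p" and a: "a \<in> {1..k}" for G a b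
    using eventually_ge_at_top[of "2 * card P"]
  proof eventually_elim
    case (elim x)
    let ?N = "norm (\<Sum>n | n \<in> {1..x} \<and> [n = b] (mod a). completely_mult G n)"
    have "L * ?N \<le> real x * sqrt (2 * L) + real D * (real x / real u)"
      unfolding L_def
    proof (rule alternating_block_cancellation[OF P u(1) _ _ D])
      show "G p = (-1) ^ card {q\<in>P. q mod D = p mod D \<and> q < p}" if "p \<in> P" for p
        using G(2) that unfolding F'_def P_def by simp
      show "a dvd D" using a unfolding D_def by (simp add: dvd_fact)
    qed (use G elim in auto)
    also have "real x * sqrt (2 * L) \<le> real x * (L / (2 * real k))"
    proof (intro mult_left_mono real_le_lsqrt)
      have "(8 * (real k)\<^sup>2) * L \<le> L * L" using L8 L1 by (intro mult_right_mono) auto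
      then show "2 * L \<le> (L / (2 * real k))\<^sup>2" using k
        by (simp add: power2_eq_square field_simps)
    qed (use L1 in auto)
    also have "real D * (real x / real u) \<le> real x * (L / (2 * real k))"
    proof -
      have "real (2 * k * D) * 1 \<le> real u * L"
        using u L1 by (intro mult_mono) (auto simp only: of_nat_le_iff)
      then have "real D / real u \<le> L / (2 * real k)" using u k by (simp add: field_simps)
      from mult_left_mono[OF this, of "real x"] show ?thesis by (simp add: mult.commute)
    qed
    finally have "L * ?N \<le> L * (real x / real k)" using k by (simp add: field_simps)
    then show ?case by (rule mult_left_le_imp_le) (use L1 in linarith)
  qed
  show "\<exists>F' y'. range F' \<subseteq> unit_circle \<and> (\<forall>p\<le>y. F' p = F p) \<and>
      (\<forall>G. range G \<subseteq> unit_circle \<longrightarrow> (\<forall>p\<le>y'. G p = F' p) \<longrightarrow> (\<forall>a\<in>{1..k}. \<forall>b. \<forall>\<^sub>F x in sequentially.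
        norm (\<Sum>n | n \<in> {1..x} \<and> [n = b] (mod a). completely_mult G n) \<le> real x / real k))"
  proof (intro exI[of _ F'] exI[of _ v] conjI allI impI ballI)
    show "range F' \<subseteq> unit_circle" by (rule range)
    show "F' p = F p" if "p \<le> y" for p by (rule agree[OF that])
  next
    fix G :: "nat \<Rightarrow> complex" and a b
    assume "range G \<subseteq> unit_circle" "\<forall>p\<le>v. G p = F' p" "a \<in> {1..k}"
    then show "\<forall>\<^sub>F x in sequentially.
        norm (\<Sum>n | n \<in> {1..x} \<and> [n = b] (mod a). completely_mult G n) \<le> real x / real k"
      by (rule cancel)
  qed
qed

lemma densely_forced_pretentious:
  "densely_forced unit_circle (\<lambda>G. \<exists>X\<ge>real k. \<exists>t. \<bar>t\<bar> \<le> X \<and>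
     pretentious_sum (completely_mult G) (\<lambda>_. 1) t X \<le> 1)"
proof (rule densely_forcedI)
  fix F :: "nat \<Rightarrow> complex" and y :: nat
  assume F: "range F \<subseteq> unit_circle"
  \<comment> \<open>There are at most \<open>y\<close> primes up to \<open>y\<close>, each
    contributing at most \<open>\<delta>\<close>, so together they stay below 1.\<close>
  define \<delta> where "\<delta> = 1 / real (Suc y)"
  obtain t where t: "\<And>p. prime p \<Longrightarrow> p \<le> y \<Longrightarrow> norm (F p * of_nat p powr (\<i> * of_real t) - 1) \<le> \<delta>"
  proof -
    have "\<exists>t. \<forall>p. prime p \<longrightarrow> p \<le> y \<longrightarrow> norm (F p * of_nat p powr (\<i> * of_real t) - 1) \<le> \<delta>"
      by (rule kronecker_primes) (use F in \<open>auto simp: \<delta>_def\<close>)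
    then show ?thesis using that by blast
  qed
  \<comment> \<open>\<open>X\<close> is chosen once \<open>t\<close> is known, so \<open>t\<close>
    is admissible at this scale. Primes between \<open>y\<close> and \<open>X\<close> contribute
    exactly 0.\<close>
  define X where "X = max k (nat \<lceil>\<bar>t\<bar>\<rceil>)"
  define F' where "F' p = (if p \<le> y then F p else cis (- t * ln (real p)))" for p
  have X: "k \<le> X" "\<bar>t\<bar> \<le> real X"
    unfolding X_def of_nat_max using real_nat_ceiling_ge[of "\<bar>t\<bar>"] by linarith+
  have range: "range F' \<subseteq> unit_circle" using F unfolding F'_def by auto
  have agree: "F' p = F p" if "p \<le> y" for p using that by (simp add: F'_def)
  have small: "pretentious_sum (completely_mult G) (\<lambda>_. 1) t (real X) \<le> 1"
    if G: "\<forall>p\<le>X. G p = F' p" for G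
  proof -
    have "pretentious_sum (completely_mult G) (\<lambda>_. 1) t (real X) =
        (\<Sum>p | prime p \<and> p \<le> X. 1 / real p * (1 - Re (F' p * of_nat p powr (\<i> * of_real t))))"
      unfolding pretentious_sum_def using G
      by (intro sum.cong) (auto simp: completely_mult_prime)
    also have "\<dots> \<le> (\<Sum>p | prime p \<and> p \<le> X. if p \<in> {1..y} then \<delta> else 0)"
    proof (intro sum_mono)
      fix p assume "p \<in> {p. prime p \<and> p \<le> X}"
      then have p: "prime p" "0 < p" by (auto simp: prime_gt_0_nat)
      show "1 / real p * (1 - Re (F' p * of_nat p powr (\<i> * of_real t))) \<le> (if p \<in> {1..y} then \<delta> else 0)"
      proof (cases "p \<le> y")
        case True
        have "1 - Re (F p * of_nat p powr (\<i> * of_real t)) \<le> \<delta>"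
          using abs_Re_le_cmod[of "F p * of_nat p powr (\<i> * of_real t) - 1"] t[OF p(1) True] by simp
        then have "1 / real p * (1 - Re (F p * of_nat p powr (\<i> * of_real t))) \<le> 1 / real p * \<delta>"
          by (intro mult_left_mono) auto
        also have "\<dots> \<le> 1 * \<delta>" using p(2) by (intro mult_right_mono) (auto simp: \<delta>_def)
        finally show ?thesis using True p(2) by (simp add: F'_def)
      next
        case False
        then show ?thesis by (simp add: F'_def natural_powr_imaginary[OF p(2)] cis_mult)
      qed
    qed
    also have "\<dots> = (\<Sum>p\<in>{p. prime p \<and> p \<le> X} \<inter> {1..y}. \<delta>)" by (subst sum.inter_restrict) auto
    also have "\<dots> \<le> (\<Sum>p\<in>{1..y}. \<delta>)" by (intro sum_mono2) (auto simp: \<delta>_def)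
    also have "\<dots> \<le> 1" by (simp add: \<delta>_def)
    finally show ?thesis .
  qed
  show "\<exists>F' y'. range F' \<subseteq> unit_circle \<and> (\<forall>p\<le>y. F' p = F p) \<and>
      (\<forall>G. range G \<subseteq> unit_circle \<longrightarrow> (\<forall>p\<le>y'. G p = F' p) \<longrightarrow>
        (\<exists>X\<ge>real k. \<exists>t. \<bar>t\<bar> \<le> X \<and> pretentious_sum (completely_mult G) (\<lambda>_. 1) t X \<le> 1))"
  proof (intro exI[of _ F'] exI[of _ X] conjI allI impI)
    fix G :: "nat \<Rightarrow> complex" assume "\<forall>p\<le>X. G p = F' p"
    then show "\<exists>X\<ge>real k. \<exists>t. \<bar>t\<bar> \<le> X \<and> pretentious_sum (completely_mult G) (\<lambda>_. 1) t X \<le> 1"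
      by (intro exI[of _ "real X"] conjI exI[of _ t] small X(2)) (use X(1) in simp_all)
  next
    show "range F' \<subseteq> unit_circle" by (rule range)
    show "F' p = F p" if "p \<le> y" for p by (rule agree[OF that])
  qed
qed

section \<open>Scales at distance of order log log from all twists\<close>

lemma sum_inverse_squares_tail_le:
  assumes "1 \<le> w"
  shows "(\<Sum>n\<in>{w<..z}. 1 / (real n)\<^sup>2) \<le> 1 / real w"
proof (cases "w \<le> z")
  case True
  have "(\<Sum>n\<in>{w<..z}. 1 / (real n)\<^sup>2) \<le> 1 / real w - 1 / real z"
    using True
  proof (induction z rule: dec_induct)
    case (step z)
    have "1 / (real (Suc z))\<^sup>2 \<le> 1 / (real z * real (Suc z))"
      using assms step by (intro divide_left_mono) (auto simp: power2_eq_square)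
    also have "\<dots> = 1 / real z - 1 / real (Suc z)"
      using assms step by (simp add: field_simps)
    finally have "1 / (real (Suc z))\<^sup>2 \<le> 1 / real z - 1 / real (Suc z)" .
    moreover have "{w<..Suc z} = insert (Suc z) {w<..z}" using step by auto
    ultimately show ?case using step by simp
  qed simp
  then show ?thesis by (rule order_trans) simp
qed simp

lemma pretentious_term_nonneg:
  assumes "0 < p" "norm u \<le> 1" "norm v \<le> 1"
  shows "0 \<le> 1 / real p * (1 - Re (u * v * of_nat p powr (\<i> * of_real t)))"
proof -
  have "norm (u * v * of_nat p powr (\<i> * of_real t)) \<le> 1"
    using mult_mono[OF assms(2,3)] assms(1) by (simp add: norm_mult natural_powr_imaginary)
  then show ?thesis
    using complex_Re_le_cmod[of "u * v * of_nat p powr (\<i> * of_real t)"] by simp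
qed

lemma norm_cis_diff_le: "norm (cis x - cis y) \<le> \<bar>x - y\<bar>"
proof -
  have "cis x - cis y = cis y * (cis (x - y) - 1)"
    by (simp add: cis_mult algebra_simps)
  then show ?thesis using norm_cis_minus_one_le[of "x - y"] by (simp add: norm_mult)
qed

text \<open>The number of pairs of a character and a point of the grid with mesh \<open>1 / z\<close> is at most
  \<open>z ^ (3 * k + 3)\<close>. Only primes above \<open>w\<close>, which is about the logarithm of that number, get balanced
  signs: this keeps both the exponents \<open>w / p\<close> below 1 and the final discrepancy bounded, while the
  primes up to \<open>w\<close> carry at most about half of the sum of \<open>1 / p\<close>.\<close>
lemma exists_unpretentious_signs:
  fixes k z w :: nat
  assumes z: "3 \<le> z" and w: "1 \<le> w" "(3 * real k + 4) * ln (real z) \<le> real w"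
  defines "P \<equiv> {p. prime p \<and> w < p \<and> p \<le> z}"
  shows "\<exists>e :: nat \<Rightarrow> real. (\<forall>p. e p = 1 \<or> e p = -1) \<and>
    (\<forall>t chi. \<bar>t\<bar> \<le> real z ^ k \<longrightarrow> chi \<in> characters_upto (ln (real z) ^ k) \<longrightarrow>
      (\<Sum>p\<in>P. 1 / real p) - 3 \<le>
      (\<Sum>p\<in>P. 1 / real p * (1 - Re (of_real (e p) * chi p * of_nat p powr (\<i> * of_real t)))))"
proof -
  define X where "X = characters_upto (ln (real z) ^ k)"
  define J where "J = {- int (z ^ (k+1)) .. int (z ^ (k+1))}"
  define r where "r chi j p = Re (chi p * cis (real_of_int j / real z * ln (real p))) / real p"
    for chi :: "nat \<Rightarrow> complex" and j p
  have lnz: "1 \<le> ln (real z)" "ln (real z) \<le> real z"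
  proof -
    show "1 \<le> ln (real z)" using z exp_le by (subst ln_ge_iff) linarith+
    show "ln (real z) \<le> real z" using z ln_le_minus_one[of "real z"] by simp
  qed
  have fin: "finite X" "finite J" "finite P" "finite (X \<times> J)"
    unfolding X_def J_def P_def by (auto intro: finite_characters_upto)
  have Ppos: "0 < p" "w < p" "p \<le> z" if "p \<in> P" for p using that unfolding P_def by auto
  have chi1: "norm (chi p) \<le> 1" if "chi \<in> X" for chi p
    using that norm_dirichlet_character_le unfolding X_def characters_upto_def by blast
  have r: "\<bar>r chi j p\<bar> \<le> 1 / real p" if "chi \<in> X" for chi j p
  proof -
    have "\<bar>Re (chi p * cis (real_of_int j / real z * ln (real p)))\<bar> \<le> 1"
      using abs_Re_le_cmod[of "chi p * cis (real_of_int j / real z * ln (real p))"] chi1[OF that, of p]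
      by (simp add: norm_mult)
    then show ?thesis unfolding r_def by (simp add: divide_right_mono)
  qed
  \<comment> \<open>Discrepancies are scaled by \<open>w\<close> before balancing. The logarithm of
    the number of twists is at most \<open>w\<close>, and so is the sum of (w/p)^2, because the tail
    of 1/n^2 beyond \<open>w\<close> is at most 1/w. Dividing the exponent 2 w by \<open>w\<close>
    leaves the bound 2. Only large positive sums reduce the distance, so a one-sided potential
    suffices.\<close>
  obtain e where e: "\<And>p. e p = 1 \<or> e p = (-1::real)"
    "(\<Sum>i\<in>X \<times> J. exp (\<Sum>p\<in>P. e p * (real w * r (fst i) (snd i) p)))
      \<le> real (card (X \<times> J)) * exp (\<Sum>p\<in>P. (real w / real p)\<^sup>2)"
  proof -
    have 1: "\<bar>real w * r (fst i) (snd i) p\<bar> \<le> real w / real p" if "i \<in> X \<times> J" "p \<in> P" for i p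
      using mult_left_mono[OF r[of "fst i" "snd i" p], of "real w"] that by (auto simp: abs_mult)
    have 2: "real w / real p \<le> 1" if "p \<in> P" for p using Ppos[OF that] by simp
    show ?thesis
      using exists_balancing_signs[OF fin(3,4), of "\<lambda>i p. real w * r (fst i) (snd i) p" "\<lambda>p. real w / real p"]
        1 2 that by blast
  qed
  have card: "real (card (X \<times> J)) \<le> real z ^ (3 * k + 3)"
  proof -
    have "real (card X) \<le> (ln (real z) ^ k)\<^sup>2"
      unfolding X_def by (rule card_characters_upto_le) (use lnz in simp)
    also have "\<dots> \<le> (real z ^ k)\<^sup>2" using lnz by (intro power_mono) auto
    finally have X: "real (card X) \<le> real z ^ (2 * k)" by (simp add: power_mult mult.commute)
    have "real (card J) = 2 * real z ^ (k + 1) + 1" unfolding J_def by simp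
    also have "\<dots> \<le> 3 * real z ^ (k + 1)"
      using one_le_power[of "real z" "k + 1"] z by simp
    also have "\<dots> \<le> real z * real z ^ (k + 1)" using z by (intro mult_right_mono) auto
    finally have J: "real (card J) \<le> real z ^ (k + 2)" by simp
    have "real (card (X \<times> J)) \<le> real z ^ (2 * k) * real z ^ (k + 2)"
      unfolding card_cartesian_product of_nat_mult using X J by (intro mult_mono) auto
    also have "\<dots> = real z ^ (3 * k + 2)" by (simp add: power_add[symmetric])
    also have "\<dots> \<le> real z ^ (3 * k + 3)" using z by (intro power_increasing) auto
    finally show ?thesis .
  qed
  have sq: "(\<Sum>p\<in>P. (real w / real p)\<^sup>2) \<le> real w"
  proof -
    have "(\<Sum>p\<in>P. (real w / real p)\<^sup>2) = (real w)\<^sup>2 * (\<Sum>p\<in>P. 1 / (real p)\<^sup>2)"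
      by (simp add: sum_distrib_left power_divide)
    also have "(\<Sum>p\<in>P. 1 / (real p)\<^sup>2) \<le> (\<Sum>n\<in>{w<..z}. 1 / (real n)\<^sup>2)"
      unfolding P_def by (intro sum_mono2) auto
    also have "\<dots> \<le> 1 / real w" by (rule sum_inverse_squares_tail_le[OF w(1)])
    finally show ?thesis using w(1) by (simp add: power2_eq_square mult_left_mono)
  qed
  have main: "(\<Sum>p\<in>P. e p * r chi j p) \<le> 2" if "chi \<in> X" "j \<in> J" for chi j
  proof -
    have "exp (real w * (\<Sum>p\<in>P. e p * r chi j p)) = exp (\<Sum>p\<in>P. e p * (real w * r chi j p))"
      by (simp add: sum_distrib_left mult_ac)
    also have "\<dots> \<le> (\<Sum>i\<in>X \<times> J. exp (\<Sum>p\<in>P. e p * (real w * r (fst i) (snd i) p)))"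
      using that fin member_le_sum[of "(chi, j)" "X \<times> J" "\<lambda>i. exp (\<Sum>p\<in>P. e p * (real w * r (fst i) (snd i) p))"]
      by simp
    also note e(2)
    also have "real (card (X \<times> J)) * exp (\<Sum>p\<in>P. (real w / real p)\<^sup>2) \<le> real z ^ (3 * k + 3) * exp (real w)"
      using card sq by (intro mult_mono) auto
    also have "\<dots> = exp (real (3 * k + 3) * ln (real z) + real w)"
      unfolding exp_add exp_of_nat_mult using z by simp
    also have "\<dots> \<le> exp (real w + real w)"
      using w(2) lnz by (simp add: algebra_simps)
    finally have "real w * (\<Sum>p\<in>P. e p * r chi j p) \<le> real w * 2" by simp
    then show ?thesis using w(1) by simp
  qed
  have "(\<Sum>p\<in>P. 1 / real p) - 3 \<le>
      (\<Sum>p\<in>P. 1 / real p * (1 - Re (of_real (e p) * chi p * of_nat p powr (\<i> * of_real t))))"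
    if t: "\<bar>t\<bar> \<le> real z ^ k" and chi: "chi \<in> X" for t chi
  proof -
    define j where "j = \<lfloor>t * real z\<rfloor>"
    have "\<bar>t * real z\<bar> \<le> real z ^ (k + 1)"
      using mult_right_mono[OF t, of "real z"] by (simp add: abs_mult mult.commute)
    then have "- real_of_int (int (z ^ (k + 1))) \<le> t * real z" "t * real z \<le> real_of_int (int (z ^ (k + 1)))"
      by (simp_all add: abs_le_iff)
    then have j: "j \<in> J" unfolding J_def j_def
      by (simp add: le_floor_iff floor_le_iff)
    have "\<bar>t * real z - real_of_int j\<bar> \<le> 1" unfolding j_def by linarith
    then have tj: "\<bar>t - real_of_int j / real z\<bar> \<le> 1 / real z"
      using z by (simp add: abs_le_iff field_simps)
    \<comment> \<open>Moving \<open>t\<close> to the grid point changes the angle by at most ln p /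
      z \<le> p / z, hence the weighted term by at most 1 / z. With at most \<open>z\<close> primes
      this costs 1, which together with the discrepancy 2 gives the loss of 3.\<close>
    have "1 / real p - e p * r chi j p - 1 / real z \<le>
        1 / real p * (1 - Re (of_real (e p) * chi p * of_nat p powr (\<i> * of_real t)))" if p: "p \<in> P" for p
    proof -
      define d where "d = cis (t * ln (real p)) - cis (real_of_int j / real z * ln (real p))"
      have lnp: "0 \<le> ln (real p)" "ln (real p) \<le> real p"
        using Ppos[OF p] ln_le_minus_one[of "real p"] by auto
      have "norm (of_real (e p) * chi p * d) \<le> 1 * 1 * (1 / real z * real p)"
        unfolding norm_mult
      proof (intro mult_mono)
        have "norm d \<le> \<bar>t - real_of_int j / real z\<bar> * ln (real p)"
        proof -
          have "\<bar>t * ln (real p) - real_of_int j / real z * ln (real p)\<bar> = \<bar>t - real_of_int j / real z\<bar> * ln (real p)"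
            using lnp(1) by (simp only: left_diff_distrib[symmetric] abs_mult abs_of_nonneg)
          then show ?thesis unfolding d_def by (metis norm_cis_diff_le)
        qed
        also have "\<dots> \<le> 1 / real z * real p" using tj lnp by (intro mult_mono) auto
        finally show "norm d \<le> 1 / real z * real p" .
        show "norm (complex_of_real (e p)) \<le> 1" using e(1)[of p] by auto
      qed (use chi1[OF chi] in auto)
      then have "Re (of_real (e p) * chi p * d) \<le> real p / real z"
        using complex_Re_le_cmod[of "of_real (e p) * chi p * d"] by simp
      then have "Re (of_real (e p) * chi p * d) / real p \<le> 1 / real z"
        using Ppos[OF p] by (simp add: field_simps)
      moreover have "Re (of_real (e p) * chi p * of_nat p powr (\<i> * of_real t)) / real p =
          e p * r chi j p + Re (of_real (e p) * chi p * d) / real p"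
      proof -
        have "of_real (e p) * chi p * of_nat p powr (\<i> * of_real t) =
            of_real (e p) * (chi p * cis (real_of_int j / real z * ln (real p))) + of_real (e p) * chi p * d"
          unfolding natural_powr_imaginary[OF Ppos(1)[OF p]] d_def by (simp add: algebra_simps)
        moreover have "Re (of_real c * v) = c * Re v" for c v by simp
        ultimately show ?thesis unfolding r_def by (simp only: plus_complex.sel add_divide_distrib times_divide_eq_right)
      qed
      ultimately show ?thesis
        by (simp only: right_diff_distrib mult_1_right times_divide_eq_left mult_1_left)
    qed
    then have "(\<Sum>p\<in>P. 1 / real p - e p * r chi j p - 1 / real z) \<le>
        (\<Sum>p\<in>P. 1 / real p * (1 - Re (of_real (e p) * chi p * of_nat p powr (\<i> * of_real t))))"
      by (rule sum_mono)
    moreover have "(\<Sum>p\<in>P. 1 / real z) \<le> 1"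
    proof -
      have "P \<subseteq> {1..z}" using Ppos by (auto simp: Suc_le_eq)
      then have "card P \<le> z" using card_mono[of "{1..z}" P] by simp
      then show ?thesis using z by simp
    qed
    ultimately show ?thesis using main[OF chi j] unfolding sum_subtractf by linarith
  qed
  then show ?thesis using e(1) unfolding X_def by blast
qed

text \<open>Since \<open>w\<close> grows like \<open>ln z\<close>, the primes up to \<open>w\<close>
  cost at most half of \<open>ln (ln z)\<close> up to a constant. About half remains for the
  balanced primes, and the quarter in the statement absorbs the constants for large
  \<open>z\<close>.\<close>

lemma densely_forced_unpretentious:
  "densely_forced unit_circle (\<lambda>G. \<exists>z::nat. k \<le> z \<and> 3 \<le> z \<and>
     (\<forall>t chi. \<bar>t\<bar> \<le> real z ^ k \<longrightarrow> chi \<in> characters_upto (ln (real z) ^ k) \<longrightarrow>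
        ln (ln (real z)) / 4 \<le> pretentious_sum (completely_mult G) chi t (real z)))"
proof (rule densely_forcedI)
  fix F :: "nat \<Rightarrow> complex" and y :: nat
  assume F: "range F \<subseteq> unit_circle"
  define K where "K = 3 * real k + 4"
  have K: "K > 0" unfolding K_def by simp
  have "\<forall>\<^sub>F z::nat in sequentially. real y + 1 \<le> K * ln (real z)"
    using K by real_asymp
  \<comment> \<open>The 5 collects the constants: 1 from the lower bound for the primes up to
    \<open>z\<close>, 1 from the upper bound for those up to \<open>w\<close>, and 3 lost in
    choosing the signs. The last logarithm bounds \<open>ln w\<close>.\<close>
  moreover have "\<forall>\<^sub>F z::nat in sequentially.
      ln (ln (real z)) / 4 \<le> ln (ln (real z)) - 5 - ln (K * ln (real z) + 1) / 2"
    using K by real_asymp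
  ultimately have "\<forall>\<^sub>F z in sequentially. max 3 k \<le> z \<and> real y + 1 \<le> K * ln (real z) \<and>
      ln (ln (real z)) / 4 \<le> ln (ln (real z)) - 5 - ln (K * ln (real z) + 1) / 2"
    using eventually_ge_at_top[of "max 3 k"] by eventually_elim blast
  then obtain z where z: "3 \<le> z" "k \<le> z" "real y + 1 \<le> K * ln (real z)"
    "ln (ln (real z)) / 4 \<le> ln (ln (real z)) - 5 - ln (K * ln (real z) + 1) / 2"
    using eventually_happens[of _ sequentially] by fastforce
  define w where "w = nat \<lceil>K * ln (real z)\<rceil>"
  have w: "K * ln (real z) \<le> real w" "real w \<le> K * ln (real z) + 1"
    unfolding w_def using z(3) by linarith+
  have yw: "y < w" using w(1) z(3) by linarith
  define P where "P = {p. prime p \<and> w < p \<and> p \<le> z}"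
  obtain e :: "nat \<Rightarrow> real" where e: "\<And>p. e p = 1 \<or> e p = -1"
    "\<And>t chi. \<bar>t\<bar> \<le> real z ^ k \<Longrightarrow> chi \<in> characters_upto (ln (real z) ^ k) \<Longrightarrow>
      (\<Sum>p\<in>P. 1 / real p) - 3 \<le>
      (\<Sum>p\<in>P. 1 / real p * (1 - Re (of_real (e p) * chi p * of_nat p powr (\<i> * of_real t))))"
    using exists_unpretentious_signs[OF z(1), of w k] w(1) yw unfolding P_def K_def by auto
  define F' where "F' p = (if p \<in> P then of_real (e p) else F p)" for p
  have "norm (complex_of_real (e p)) = 1" for p using e(1)[of p] by auto
  then have "range F' \<subseteq> unit_circle" using F unfolding F'_def by auto
  moreover have "\<forall>p\<le>y. F' p = F p" using yw unfolding F'_def P_def by auto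
  moreover have "ln (ln (real z)) / 4 \<le> pretentious_sum (completely_mult G) chi t (real z)"
    if G: "range G \<subseteq> unit_circle" "\<forall>p\<le>z. G p = F' p"
      and t: "\<bar>t\<bar> \<le> real z ^ k" and chi: "chi \<in> characters_upto (ln (real z) ^ k)" for G t chi
  proof -
    have "(\<Sum>p | prime p \<and> p \<le> z. 1 / real p) \<le> (\<Sum>p\<in>{p. prime p \<and> p \<le> w} \<union> P. 1 / real p)"
      unfolding P_def by (intro sum_mono2) auto
    also have "\<dots> = (\<Sum>p | prime p \<and> p \<le> w. 1 / real p) + (\<Sum>p\<in>P. 1 / real p)"
      unfolding P_def by (intro sum.union_disjoint) auto
    finally have "ln (ln (real z)) - 1 \<le> 1 + ln (real w) / 2 + (\<Sum>p\<in>P. 1 / real p)"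
      using prime_reciprocals_ge[of z] prime_reciprocals_le[of w] z yw by simp
    moreover have "ln (real w) \<le> ln (K * ln (real z) + 1)"
      using w yw by (subst ln_le_cancel_iff) auto
    ultimately have "ln (ln (real z)) / 4 \<le> (\<Sum>p\<in>P. 1 / real p) - 3" using z(4) by linarith
    also note e(2)[OF t chi]
    also have "(\<Sum>p\<in>P. 1 / real p * (1 - Re (of_real (e p) * chi p * of_nat p powr (\<i> * of_real t)))) =
        (\<Sum>p\<in>P. 1 / real p * (1 - Re (completely_mult G p * chi p * of_nat p powr (\<i> * of_real t))))"
      using G(2) by (intro sum.cong refl) (auto simp: P_def F'_def completely_mult_prime)
    also have "\<dots> \<le> pretentious_sum (completely_mult G) chi t (real z)"
      unfolding pretentious_sum_def
    proof (intro sum_mono2)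
      fix p assume "p \<in> {p. prime p \<and> real p \<le> real z} - P"
      moreover have "norm (completely_mult G p) \<le> 1"
        using G(1) norm_completely_mult[of G p] by (simp add: image_subset_iff)
      moreover have "norm (chi p) \<le> 1"
        using chi norm_dirichlet_character_le unfolding characters_upto_def by blast
      ultimately show "0 \<le> 1 / real p * (1 - Re (completely_mult G p * chi p * of_nat p powr (\<i> * of_real t)))"
        by (intro pretentious_term_nonneg) (auto simp: prime_gt_0_nat)
    qed (auto simp: P_def)
    finally show ?thesis .
  qed
  ultimately show "\<exists>F' y'. range F' \<subseteq> unit_circle \<and> (\<forall>p\<le>y. F' p = F p) \<and>
      (\<forall>G. range G \<subseteq> unit_circle \<longrightarrow> (\<forall>p\<le>y'. G p = F' p) \<longrightarrow>
        (\<exists>z::nat. k \<le> z \<and> 3 \<le> z \<and>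
          (\<forall>t chi. \<bar>t\<bar> \<le> real z ^ k \<longrightarrow> chi \<in> characters_upto (ln (real z) ^ k) \<longrightarrow>
            ln (ln (real z)) / 4 \<le> pretentious_sum (completely_mult G) chi t (real z))))"
    using z(1,2) by blast
qed

section \<open>Aperiodicity, and failure of the other two notions\<close>

text \<open>The numbers a n + b with 1 \<le> n \<le> N are the members of the residue class between
  b + 1 and a N + b, so the two kinds of sums differ by at most \<open>b\<close> unimodular
  terms.\<close>

lemma aperiodic_completely_mult:
  assumes F: "\<And>p. norm (F p) = 1"
    and cancel: "\<And>k a b. 1 \<le> a \<Longrightarrow> a \<le> k \<Longrightarrow> \<forall>\<^sub>F x in sequentially.
      norm (\<Sum>n | n \<in> {1..x} \<and> [n = b] (mod a). completely_mult F n) \<le> real x / real k"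
  shows "aperiodic (completely_mult F)"
  unfolding aperiodic_def
proof (intro allI impI)
  fix a b :: nat
  assume a: "1 \<le> a"
  define g where "g = completely_mult F"
  have g1: "norm (g n) = 1" for n unfolding g_def by (rule norm_completely_mult[OF F])
  have decomp: "norm (\<Sum>n=1..N. g (a * n + b)) \<le>
      norm (\<Sum>n | n \<in> {1..a * N + b} \<and> [n = b] (mod a). g n) + real b" for N
  proof -
    define T where "T x = {n. n \<in> {1..x} \<and> [n = b] (mod a)}" for x
    have fin: "finite (T x)" for x unfolding T_def by simp
    have "(\<Sum>n=1..N. g (a * n + b)) = (\<Sum>n\<in>T (a * N + b) - T b. g n)"
    proof (rule sum.reindex_bij_witness[of _ "\<lambda>m. (m - b) div a" "\<lambda>n. a * n + b"])
      fix n assume n: "n \<in> {1..N}"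
      then show "a * n + b \<in> T (a * N + b) - T b" "(a * n + b - b) div a = n"
        using a n by (auto simp: T_def cong_def Suc_le_eq)
    next
      fix m assume m: "m \<in> T (a * N + b) - T b"
      then have mb: "b < m" "m \<le> a * N + b" "[m = b] (mod a)" unfolding T_def by auto
      then have "a dvd m - b" by (simp add: cong_altdef_nat)
      then obtain n where n: "m - b = a * n" by blast
      then have "m = a * n + b" using mb(1) by simp
      then show "a * ((m - b) div a) + b = m" "(m - b) div a \<in> {1..N}"
        using a mb by (auto simp: Suc_le_eq intro: gr0I)
    qed simp
    also have "\<dots> = (\<Sum>n\<in>T (a * N + b). g n) - (\<Sum>n\<in>T b. g n)"
      using fin by (intro sum_diff) (auto simp: T_def)
    also have "norm \<dots> \<le> norm (\<Sum>n\<in>T (a * N + b). g n) + norm (\<Sum>n\<in>T b. g n)"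
      by (rule norm_triangle_ineq4)
    also have "norm (\<Sum>n\<in>T b. g n) \<le> (\<Sum>n\<in>T b. 1)"
      by (rule order_trans[OF norm_sum]) (simp add: g1)
    also have "\<dots> \<le> (\<Sum>n=1..b. 1)" by (intro sum_mono2) (auto simp: T_def)
    finally show ?thesis by (simp add: T_def)
  qed
  show "(\<lambda>N. (\<Sum>n=1..N. g (a * n + b)) / of_nat N) \<longlonglongrightarrow> 0"
  proof (rule tendstoI)
    fix \<epsilon> :: real assume \<epsilon>: "0 < \<epsilon>"
    \<comment> \<open>Dividing by N instead of a N + b leaves about a / k, so \<open>k\<close> has
      to exceed 2 a / \<epsilon>; it has to exceed \<open>a\<close> as well for the assumed
      cancellation to apply to modulus \<open>a\<close>.\<close>
    obtain k :: nat where k: "real a + 2 * real a / \<epsilon> < real k" using reals_Archimedean2 by blast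
    have "0 \<le> 2 * real a / \<epsilon>" using \<epsilon> by simp
    then have ak: "a \<le> k" "2 * real a / \<epsilon> < real k" using k by linarith+
    then have k0: "0 < real k" "real a / real k < \<epsilon> / 2" using a \<epsilon> by (auto simp: field_simps)
    have "filterlim (\<lambda>N. a * N + b) at_top sequentially"
    proof (rule filterlim_at_top_mono[OF filterlim_ident])
      show "\<forall>\<^sub>F N in sequentially. N \<le> a * N + b"
        using a by (intro always_eventually allI) (simp add: trans_le_add1)
    qed
    then have 1: "\<forall>\<^sub>F N in sequentially.
        norm (\<Sum>n | n \<in> {1..a * N + b} \<and> [n = b] (mod a). g n) \<le> real (a * N + b) / real k"
      using cancel[OF a ak(1)] unfolding g_def by (rule eventually_compose_filterlim[rotated])
    have "(\<lambda>N. (real b / real k + real b) / real N) \<longlonglongrightarrow> 0" by (rule lim_const_over_n)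
    then have 2: "\<forall>\<^sub>F N in sequentially. (real b / real k + real b) / real N < \<epsilon> / 2"
      using \<epsilon> by (intro order_tendstoD(2)[of _ 0]) auto
    show "\<forall>\<^sub>F N in sequentially. dist ((\<Sum>n=1..N. g (a * n + b)) / of_nat N) 0 < \<epsilon>"
      using 1 2 eventually_gt_at_top[of 0]
    proof eventually_elim
      case (elim N)
      have "norm (\<Sum>n=1..N. g (a * n + b)) \<le> real (a * N + b) / real k + real b"
        using decomp[of N] elim(1) by linarith
      then have "norm (\<Sum>n=1..N. g (a * n + b)) / real N \<le> (real (a * N + b) / real k + real b) / real N"
        by (rule divide_right_mono) simp
      also have "\<dots> = real a / real k + (real b / real k + real b) / real N"
        using elim(3) by (simp add: add_divide_distrib)
      also have "\<dots> < \<epsilon>" using k0(2) elim(2) by linarith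
      finally show ?case by (simp add: norm_divide)
    qed
  qed
qed

lemma min_pretentious_sum_le:
  assumes f: "f \<in> bounded_multiplicative" and t: "\<bar>t\<bar> \<le> T" and chi: "chi \<in> characters_upto Q"
  shows "min_pretentious_sum f X T Q \<le> pretentious_sum f chi t X"
  unfolding min_pretentious_sum_def
proof (rule cINF_lower2)
  show "bdd_below ((\<lambda>t. MIN chi\<in>characters_upto Q. pretentious_sum f chi t X) ` {t. \<bar>t\<bar> \<le> T})"
  proof (rule bdd_belowI2)
    show "0 \<le> (MIN chi\<in>characters_upto Q. pretentious_sum f chi t X)" for t
      using chi finite_characters_upto pretentious_sum_nonneg[OF f]
      by (intro Min.boundedI) auto
  qed
  show "t \<in> {t. \<bar>t\<bar> \<le> T}" using t by simp
  show "(MIN chi\<in>characters_upto Q. pretentious_sum f chi t X) \<le> pretentious_sum f chi t X"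
    using chi by (intro Min_le finite_imageI finite_characters_upto imageI)
qed

lemma min_pretentious_sum_ge:
  assumes "0 \<le> T" "1 \<le> Q"
    and "\<And>t chi. \<bar>t\<bar> \<le> T \<Longrightarrow> chi \<in> characters_upto Q \<Longrightarrow> B \<le> pretentious_sum f chi t X"
  shows "B \<le> min_pretentious_sum f X T Q"
  unfolding min_pretentious_sum_def
proof (rule cINF_greatest)
  show "{t. \<bar>t\<bar> \<le> T} \<noteq> {}" using assms(1) by (auto intro: exI[of _ 0])
  show "B \<le> (MIN chi\<in>characters_upto Q. pretentious_sum f chi t X)" if "t \<in> {t. \<bar>t\<bar> \<le> T}" for t
    using that assms(3) characters_upto_nonempty[OF assms(2)] finite_characters_upto
    by (intro Min.boundedI) auto
qed

lemma not_strongly_aperiodicI: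
  assumes f: "f \<in> bounded_multiplicative"
    and "\<And>k::nat. \<exists>X\<ge>real k. \<exists>t. \<bar>t\<bar> \<le> X \<and> pretentious_sum f (\<lambda>_. 1) t X \<le> 1"
  shows "\<not> strongly_aperiodic f"
proof
  assume "strongly_aperiodic f"
  then have "filterlim (\<lambda>X. min_pretentious_sum f X X 1) at_top at_top"
    unfolding strongly_aperiodic_def by simp
  then have "\<forall>\<^sub>F X in at_top. 2 \<le> min_pretentious_sum f X X 1"
    by (simp add: filterlim_at_top)
  then obtain X0 where X0: "\<And>X. X0 \<le> X \<Longrightarrow> 2 \<le> min_pretentious_sum f X X 1"
    unfolding eventually_at_top_linorder by blast
  obtain k :: nat where "X0 \<le> real k" using real_arch_simple by blast
  obtain X t where X: "real k \<le> X" "\<bar>t\<bar> \<le> X" "pretentious_sum f (\<lambda>_. 1) t X \<le> 1"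
    using assms(2)[of k] by blast
  have "(\<lambda>_. 1) \<in> characters_upto 1"
    unfolding characters_upto_def dirichlet_character_def by (auto intro!: exI[of _ 1])
  then have "min_pretentious_sum f X X 1 \<le> 1"
    using min_pretentious_sum_le[OF f X(2), of "\<lambda>_. 1" 1 X] X(3) by linarith
  moreover have "2 \<le> min_pretentious_sum f X X 1" using X0[of X] X(1) \<open>X0 \<le> real k\<close> by simp
  ultimately show False by simp
qed

text \<open>One \<open>k\<close> serves two purposes: it pushes \<open>z\<close> past any threshold,
  and being at least \<open>A\<close> it makes the ranges for the exponent \<open>k\<close> contain
  those for \<open>A\<close>. The bound \<open>3 \<le> z\<close> gives \<open>ln z > 1\<close>, so
  powers of \<open>ln z\<close> are monotone in the exponent and \<open>ln (ln z)\<close> is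
  positive.\<close>

lemma not_moderately_aperiodicI:
  assumes "\<And>k::nat. \<exists>z::nat. k \<le> z \<and> 3 \<le> z \<and>
     (\<forall>t chi. \<bar>t\<bar> \<le> real z ^ k \<longrightarrow> chi \<in> characters_upto (ln (real z) ^ k) \<longrightarrow>
        ln (ln (real z)) / 4 \<le> pretentious_sum f chi t (real z))"
  shows "\<not> moderately_aperiodic f"
proof
  assume "moderately_aperiodic f"
  then obtain A where A: "A > 0"
    "((\<lambda>X. 1 / ln (ln X) * min_pretentious_sum f X (X powr A) (ln X powr A)) \<longlongrightarrow> 0) at_top"
    unfolding moderately_aperiodic_def by blast
  have "\<forall>\<^sub>F X in at_top. 1 / ln (ln X) * min_pretentious_sum f X (X powr A) (ln X powr A) < 1 / 4"
    by (rule order_tendstoD(2)[OF A(2)]) simp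
  then obtain X0 where X0: "\<And>X. X0 \<le> X \<Longrightarrow>
      1 / ln (ln X) * min_pretentious_sum f X (X powr A) (ln X powr A) < 1 / 4"
    unfolding eventually_at_top_linorder by blast
  obtain k :: nat where k: "max X0 A \<le> real k" using real_arch_simple by blast
  obtain z :: nat where z: "k \<le> z" "3 \<le> z" and far:
    "\<And>t chi. \<bar>t\<bar> \<le> real z ^ k \<Longrightarrow> chi \<in> characters_upto (ln (real z) ^ k) \<Longrightarrow>
        ln (ln (real z)) / 4 \<le> pretentious_sum f chi t (real z)"
    using assms[of k] by blast
  have "exp 1 < (3::real)" using e_less_272 by simp
  then have "exp 1 < real z" using z(2) by linarith
  then have lnz: "1 < ln (real z)" using z(2) using exp_less_cancel_iff[of 1 "ln (real z)"] by simp
  have zA: "real z powr A \<le> real z ^ k" "ln (real z) powr A \<le> ln (real z) ^ k"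
    using k z(2) lnz by (simp_all add: powr_mono flip: powr_realpow)
  have "ln (ln (real z)) / 4 \<le> min_pretentious_sum f (real z) (real z powr A) (ln (real z) powr A)"
  proof (rule min_pretentious_sum_ge)
    show "1 \<le> ln (real z) powr A" using lnz A(1) by (simp add: ge_one_powr_ge_zero)
    fix t :: real and chi assume "\<bar>t\<bar> \<le> real z powr A" "chi \<in> characters_upto (ln (real z) powr A)"
    then show "ln (ln (real z)) / 4 \<le> pretentious_sum f chi t (real z)"
      using zA by (intro far) (auto simp: characters_upto_def)
  qed simp
  moreover have "0 < ln (ln (real z))" using lnz by simp
  ultimately have "1 / 4 \<le> 1 / ln (ln (real z)) * min_pretentious_sum f (real z) (real z powr A) (ln (real z) powr A)"
    by (simp add: field_simps)
  moreover have "X0 \<le> real z" using k z(1) by simp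
  ultimately show False using X0[of "real z"] by simp
qed

theorem mainTheorem15:
  shows "\<exists>f \<in> bounded_multiplicative.
           aperiodic f \<and> \<not> strongly_aperiodic f \<and> \<not> moderately_aperiodic f"
proof -
  define R1 where "R1 k G \<longleftrightarrow> (\<forall>a\<in>{1..k}. \<forall>b. \<forall>\<^sub>F x in sequentially.
    norm (\<Sum>n | n \<in> {1..x} \<and> [n = b] (mod a). completely_mult G n) \<le> real x / real k)"
    for k :: nat and G
  define R2 where "R2 k G \<longleftrightarrow> (\<exists>z::nat. k \<le> z \<and> 3 \<le> z \<and>
     (\<forall>t chi. \<bar>t\<bar> \<le> real z ^ k \<longrightarrow> chi \<in> characters_upto (ln (real z) ^ k) \<longrightarrow>
        ln (ln (real z)) / 4 \<le> pretentious_sum (completely_mult G) chi t (real z)))"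
    for k :: nat and G
  define R3 where "R3 k G \<longleftrightarrow> (\<exists>X\<ge>real k. \<exists>t. \<bar>t\<bar> \<le> X \<and>
     pretentious_sum (completely_mult G) (\<lambda>_. 1) t X \<le> 1)" for k :: nat and G
  \<comment> \<open>The shift to \<open>Suc k\<close> meets the condition that \<open>k\<close> be
    positive, so that all natural numbers can index the combined requirement.\<close>
  have "densely_forced unit_circle (R1 (Suc k))" for k
    unfolding R1_def by (rule densely_forced_progression_cancellation) simp
  moreover have "densely_forced unit_circle (R2 k)" for k
    unfolding R2_def by (rule densely_forced_unpretentious)
  moreover have "densely_forced unit_circle (R3 k)" for k
    unfolding R3_def by (rule densely_forced_pretentious)
  ultimately have "densely_forced unit_circle (\<lambda>G. R1 (Suc k) G \<and> R2 k G \<and> R3 k G)" for k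
    by (intro densely_forced_conj)
  moreover have "unit_circle \<noteq> {}" by (auto intro: exI[of _ 1])
  ultimately obtain G where G: "range G \<subseteq> unit_circle" "\<And>k. R1 (Suc k) G" "\<And>k. R2 k G" "\<And>k. R3 k G"
    using generic_function_exists[of unit_circle "\<lambda>k G. R1 (Suc k) G \<and> R2 k G \<and> R3 k G"] by blast
  have norm: "norm (G p) = 1" for p using G(1) by (auto simp: image_subset_iff)
  have bm: "completely_mult G \<in> bounded_multiplicative"
    by (rule completely_mult_bounded_multiplicative[OF norm])
  have "aperiodic (completely_mult G)"
  proof (rule aperiodic_completely_mult[OF norm])
    fix k a b :: nat assume "1 \<le> a" "a \<le> k"
    then show "\<forall>\<^sub>F x in sequentially.
        norm (\<Sum>n | n \<in> {1..x} \<and> [n = b] (mod a). completely_mult G n) \<le> real x / real k"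
      using G(2)[of "k - 1"] unfolding R1_def by simp
  qed
  moreover have "\<not> strongly_aperiodic (completely_mult G)"
    using G(4) unfolding R3_def by (rule not_strongly_aperiodicI[OF bm])
  moreover have "\<not> moderately_aperiodic (completely_mult G)"
    using G(3) unfolding R2_def by (rule not_moderately_aperiodicI)
  ultimately show ?thesis using bm by blast
qed

end
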